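(* Let $1 \le \alpha < \omega_1$ be an ordinal. Then there is a closed set $F \subset 2^{\omega} \times \omega^{\omega}$ such that for every $x \in 2^{\omega}$ the section $F_x = \{y \in \omega^\omega : (x,y) \in F\}$ is a two-point set, and $F$ cannot be covered by countably many sets $B(n) \subset F$, $n \in \omega$, such that each $B(n)$ belongs to the Borel class $\boldsymbol{\Sigma}^0_\alpha(2^\omega\times\omega^\omega)$ and the section $B(n)_x$ contains at most one point for every $n \in \omega$ and every $x \in 2^{\omega}$.
   Context: $2^\omega$ is the Cantor space and $\omega^\omega$ the Baire space, with product topologies. $\boldsymbol{\Sigma}^0_\alpha$ denotes the additive Borel class of rank $\alpha$ (so $\boldsymbol{\Sigma}^0_1$ = open sets). For $B \subset X\times Y$ and $x\in X$, $B_x=\{y\in Y:(x,y)\in B\}$. *)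

theory Defs
  imports "HOL-Analysis.Analysis"
begin

definition cantor_top :: "(nat \<Rightarrow> bool) topology" where
  "cantor_top = product_topology (\<lambda>_. discrete_topology UNIV) UNIV"

definition baire_top :: "(nat \<Rightarrow> nat) topology" where
  "baire_top = product_topology (\<lambda>_. discrete_topology UNIV) UNIV"

definition CB_top :: "((nat \<Rightarrow> bool) \<times> (nat \<Rightarrow> nat)) topology" where
  "CB_top = prod_topology cantor_top baire_top"

text \<open>Additive Borel classes.  Countable ordinals are represented by points of
  countable well-orders: for a countable well-order r and a in Field r, let beta be
  the order type of the strict initial segment of r below a.  Then
  Sigma_class X r a is the class Sigma^0_(1+beta)(X): the open sets, together with
  countable unions of complements of sets of classes Sigma^0_(1+gamma), gamma < beta.
  Every ordinal 1 <= alpha < omega_1 is of the form 1+beta with beta countable.\<close>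

inductive Sigma_class :: "'a topology \<Rightarrow> ('b \<times> 'b) set \<Rightarrow> 'b \<Rightarrow> 'a set \<Rightarrow> bool"
  for X :: "'a topology" and r :: "('b \<times> 'b) set" where
  open_class: "openin X S \<Longrightarrow> Sigma_class X r a S"
| union_class: "(\<And>n::nat. \<exists>b. (b, a) \<in> r \<and> b \<noteq> a \<and> A n \<subseteq> topspace X
                      \<and> Sigma_class X r b (topspace X - A n))
                \<Longrightarrow> Sigma_class X r a (\<Union>n::nat. A n)"

end

theory Submission
  imports Defs
begin

text \<open>
  A point \<open>x\<close> of the Cantor space codes, for every binary string \<open>s\<close> and every \<open>n\<close>, a bit
  (a label) and a statement \<open>T x s n\<close> of multiplicative class just beyond those allowed in the
  pieces of a cover.  A branch \<open>i\<close> is admissible for \<open>x\<close> if every true statement at a string on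
  \<open>i\<close> carries the label by which \<open>i\<close> continues, while every string off \<open>i\<close> has a true statement,
  all with the same label.  Two admissible branches part at a string without true statements, and
  every admissible branch passes through such a string, so there are at most two of them.
  The truth values that make \<open>i\<close> admissible have unique evidence, which together with \<open>i\<close> is put
  into the second coordinate and makes the set closed.  Sections with fewer than two points form
  Borel sets and are filled up by values of functions with closed graph.

  The evidence carried by \<open>(i, x)\<close> says nothing about statements on \<open>i\<close> with the right label.  If
  the set were covered as forbidden, some piece would contain a set of lower class that is
  comeager near some \<open>(i, x)\<close>, in a finer topology which still does not decide statements of
  full rank on \<open>i\<close>.  A retagging argument, by induction on the class, transfers this to the space
  of those points whose two branches part at a fixed long string on \<open>i\<close>.  There exchanging the
  two branches is a homeomorphism, so the piece contains both points of a section.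
\<close>

section \<open>Baire category in spaces of integer sequences\<close>

text \<open>The obvious cover sorts points by the parting string and the bit after it. Its pieces
  say that some string on the branch has no true statement; if the evidence settled this, they would
  be closed. So the evidence leaves open the statements that agree with the branch, and settles all
  others because membership in \<open>F\<close> depends on them. This is the distinction made by
  \<open>visible\<close>. The category argument cannot stay in \<open>F\<close>. A generic point of
  \<open>F\<close> (ranks below \<open>a\<close> being decided) has no true statement anywhere on
  its branch, whereas a second branch would need one at every string that it avoids. So generic
  points have no partner, and the union of the sets \<open>G s\<close> is meager in
  \<open>F\<close>. A piece that is comeager near a point of \<open>F\<close> therefore says nothing
  directly about pairs. The passage to \<open>G s\<close> is a category form of the retagging in
  Steel forcing, with the ranks of known facts as tags: finitely many facts about a point of one
  space can be realized in the other, provided that ranks are lowered as far as the class of the set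
  permits.\<close>

locale code_space =
  fixes M :: "'z set" and obs_seq :: "'z \<Rightarrow> nat \<Rightarrow> nat"
  assumes limit: "\<lbrakk>\<And>k. u k \<in> M; \<And>p. \<forall>\<^sub>F k in sequentially. obs_seq (u k) p = g p\<rbrakk> \<Longrightarrow> \<exists>z\<in>M. obs_seq z = g"
begin

text \<open>Basic neighbourhoods of the topology induced by \<open>obs_seq\<close>. The locale axiom
  says that the image of \<open>M\<close> is closed in the Baire space, which is the completeness
  behind \<open>Baire\<close>.\<close>

definition cyl :: "'z \<Rightarrow> nat \<Rightarrow> 'z set" where
  "cyl u N = {v\<in>M. \<forall>p<N. obs_seq v p = obs_seq u p}"

definition nowhere_dense :: "'z set \<Rightarrow> bool" where
  "nowhere_dense X \<longleftrightarrow> (\<forall>u\<in>M. \<forall>N. \<exists>v\<in>cyl u N. \<exists>K\<ge>N. cyl v K \<inter> X = {})"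

definition meager :: "'z set \<Rightarrow> bool" where
  "meager X \<longleftrightarrow> (\<exists>C :: nat \<Rightarrow> 'z set. (\<forall>n. nowhere_dense (C n)) \<and> X \<inter> M \<subseteq> (\<Union>n. C n))"

definition is_open :: "'z set \<Rightarrow> bool" where
  "is_open X \<longleftrightarrow> (\<forall>u\<in>X \<inter> M. \<exists>N. cyl u N \<subseteq> X)"

lemma cyl_self: "u \<in> M \<Longrightarrow> u \<in> cyl u N"
  by (simp add: cyl_def)

lemma cyl_M: "v \<in> cyl u N \<Longrightarrow> v \<in> M"
  by (simp add: cyl_def)

lemma cyl_sub: "v \<in> cyl u N \<Longrightarrow> N \<le> K \<Longrightarrow> cyl v K \<subseteq> cyl u N"
  by (auto simp: cyl_def)

lemma cyl_mono: "N \<le> K \<Longrightarrow> cyl v K \<subseteq> cyl v N"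
  by (auto simp: cyl_def)

lemma is_open_cyl: "is_open (cyl u N)"
  unfolding is_open_def using cyl_sub by blast

lemma is_open_Int: "is_open X \<Longrightarrow> is_open Y \<Longrightarrow> is_open (X \<inter> Y)"
  unfolding is_open_def
proof (intro ballI)
  fix u assume X: "\<forall>u\<in>X \<inter> M. \<exists>N. cyl u N \<subseteq> X" and Y: "\<forall>u\<in>Y \<inter> M. \<exists>N. cyl u N \<subseteq> Y"
    and u: "u \<in> X \<inter> Y \<inter> M"
  obtain N K where "cyl u N \<subseteq> X" "cyl u K \<subseteq> Y" using X Y u by blast
  then have "cyl u (max N K) \<subseteq> X \<inter> Y" using cyl_mono[of N "max N K"] cyl_mono[of K "max N K"] by fastforce
  then show "\<exists>N. cyl u N \<subseteq> X \<inter> Y" by blast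
qed

lemma meager_subset: "meager X \<Longrightarrow> Y \<inter> M \<subseteq> X \<Longrightarrow> meager Y"
  unfolding meager_def by blast

lemma meager_nowhere_dense: "nowhere_dense X \<Longrightarrow> meager X"
  unfolding meager_def by (rule exI[of _ "\<lambda>_. X"]) auto

lemma meager_empty: "meager {}"
  by (rule meager_nowhere_dense) (use cyl_self in \<open>auto simp: nowhere_dense_def\<close>)

lemma meager_UN:
  fixes X :: "nat \<Rightarrow> 'z set"
  assumes "\<And>n. meager (X n)" shows "meager (\<Union>n. X n)"
proof -
  have "\<forall>n. \<exists>C :: nat \<Rightarrow> 'z set. (\<forall>m. nowhere_dense (C m)) \<and> X n \<inter> M \<subseteq> (\<Union>m. C m)"
    using assms by (auto simp: meager_def)
  then obtain C :: "nat \<Rightarrow> nat \<Rightarrow> 'z set"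
    where C: "\<And>n m. nowhere_dense (C n m)" "\<And>n. X n \<inter> M \<subseteq> (\<Union>m. C n m)"
    by metis
  define C' where "C' k = (case prod_decode k of (n, m) \<Rightarrow> C n m)" for k
  have "x \<in> (\<Union>k. C' k)" if x: "x \<in> (\<Union>n. X n) \<inter> M" for x
  proof -
    obtain n m where "x \<in> C n m" using x C(2) by blast
    then have "x \<in> C' (prod_encode (n, m))" by (simp add: C'_def)
    then show ?thesis by blast
  qed
  moreover have "nowhere_dense (C' k)" for k by (auto simp: C'_def C(1) split: prod.split)
  ultimately show ?thesis unfolding meager_def by blast
qed

lemma meager_UN_countable:
  assumes "countable I" "\<And>i. i \<in> I \<Longrightarrow> meager (X i)" shows "meager (\<Union>i\<in>I. X i)"
proof (cases "I = {}")
  case True then show ?thesis by (simp add: meager_empty)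
next
  case False
  have "meager (\<Union>n. X (from_nat_into I n))"
    by (rule meager_UN) (simp add: assms(2) from_nat_into[OF False])
  moreover have "(\<Union>i\<in>I. X i) \<subseteq> (\<Union>n. X (from_nat_into I n))"
    using from_nat_into_surj[OF assms(1)] by fastforce
  ultimately show ?thesis using meager_subset by blast
qed

lemma meager_Un: assumes "meager X" "meager Y" shows "meager (X \<union> Y)"
proof -
  have "meager (\<Union>Z\<in>{X, Y}. Z)" by (rule meager_UN_countable) (use assms in auto)
  then show ?thesis by simp
qed

text \<open>The radii of the nested cylinders grow beyond every bound, so all coordinates become
  fixed, and \<open>limit\<close> supplies a point of \<open>M\<close> with these
  coordinates.\<close>

theorem Baire: assumes "u \<in> M" shows "\<not> meager (cyl u N)"
proof
  assume "meager (cyl u N)"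
  then obtain C :: "nat \<Rightarrow> 'z set" where C: "\<And>n. nowhere_dense (C n)" "cyl u N \<inter> M \<subseteq> (\<Union>n. C n)"
    unfolding meager_def by blast
  define Q where "Q n p \<longleftrightarrow> fst p \<in> cyl u N \<and> n \<le> snd p" for n :: nat and p :: "'z \<times> nat"
  define R where "R n p q \<longleftrightarrow> fst q \<in> cyl (fst p) (snd p) \<and> snd p \<le> snd q
      \<and> cyl (fst q) (snd q) \<inter> C n = {} \<and> N \<le> snd q" for n :: nat and p q :: "'z \<times> nat"
  have step: "\<exists>q. Q (Suc n) q \<and> R n p q" if "Q n p" for n p
  proof -
    obtain v K where p: "p = (v, K)" by force
    have v: "v \<in> cyl u N" "n \<le> K" using that p by (auto simp: Q_def)
    obtain w L where w: "w \<in> cyl v (max N K)" "L \<ge> max N K" "cyl w L \<inter> C n = {}"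
      using C(1)[of n] v cyl_M unfolding nowhere_dense_def by blast
    have "cyl w (Suc L) \<inter> C n = {}" using w cyl_mono[of L "Suc L" w] by auto
    then have "Q (Suc n) (w, Suc L) \<and> R n p (w, Suc L)"
      using w v cyl_sub[OF v(1), of "max N K"] cyl_mono[of K "max N K" v] by (auto simp: Q_def R_def p)
    then show ?thesis by blast
  qed
  have "\<exists>f. \<forall>n. Q n (f n) \<and> R n (f n) (f (Suc n))"
  proof (rule dependent_nat_choice[of Q R])
    show "\<exists>p. Q 0 p" using cyl_self[OF assms] by (auto simp: Q_def)
  qed (use step in auto)
  then obtain f where f: "\<And>n. Q n (f n)" "\<And>n. R n (f n) (f (Suc n))" by blast
  have "cyl (fst (f (Suc n))) (snd (f (Suc n))) \<subseteq> cyl (fst (f n)) (snd (f n))" for n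
    using f(2)[of n] cyl_sub unfolding R_def by blast
  then have nest: "cyl (fst (f m)) (snd (f m)) \<subseteq> cyl (fst (f n)) (snd (f n))" if "n \<le> m" for n m
    using lift_Suc_antimono_le[of "\<lambda>n. cyl (fst (f n)) (snd (f n))", OF _ that] by blast
  have fM: "fst (f n) \<in> M" for n using f(1)[of n] cyl_M by (auto simp: Q_def)
  have inb: "fst (f m) \<in> cyl (fst (f n)) (snd (f n))" if "n \<le> m" for n m
    using nest[OF that] cyl_self[OF fM] by blast
  define g where "g p = obs_seq (fst (f (Suc p))) p" for p
  have conv: "obs_seq (fst (f m)) p = g p" if "m \<ge> Suc p" for m p
  proof -
    have "p < snd (f (Suc p))" using f(1)[of "Suc p"] by (simp add: Q_def)
    then show ?thesis using inb[OF that] by (simp add: cyl_def g_def)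
  qed
  obtain z where z: "z \<in> M" "obs_seq z = g"
  proof -
    have "\<forall>\<^sub>F k in sequentially. obs_seq (fst (f k)) p = g p" for p
      using conv eventually_sequentially by blast
    then show ?thesis using limit[of "\<lambda>k. fst (f k)" g] fM that by blast
  qed
  have zb: "z \<in> cyl (fst (f n)) (snd (f n))" for n
  proof -
    have "obs_seq z p = obs_seq (fst (f n)) p" if "p < snd (f n)" for p
    proof -
      have "obs_seq (fst (f (max n (Suc p)))) p = obs_seq (fst (f n)) p"
        using inb[of n "max n (Suc p)"] that by (simp add: cyl_def)
      then show ?thesis using conv[of p "max n (Suc p)"] z by simp
    qed
    then show ?thesis using z by (simp add: cyl_def)
  qed
  have "z \<in> cyl u N"
    using zb[of 1] f(1)[of 1] f(2)[of 0] cyl_sub[of "fst (f 1)" u N "snd (f 1)"] by (auto simp: Q_def R_def)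
  moreover have "z \<notin> C n" for n using zb[of "Suc n"] f(2)[of n] by (auto simp: R_def)
  ultimately show False using C(2) z by blast
qed

lemma is_open_not_meager: "is_open X \<Longrightarrow> u \<in> X \<inter> M \<Longrightarrow> \<not> meager X"
  unfolding is_open_def using Baire[of u] meager_subset by (metis IntD2 inf.coboundedI1)

text \<open>The Banach category theorem. It is elementary here because a cylinder is named by a
  finite list of integers, so there are only countably many.\<close>

lemma meager_locally:
  assumes "\<And>u N. u \<in> M \<Longrightarrow> \<exists>v\<in>cyl u N. \<exists>K\<ge>N. meager (cyl v K \<inter> X)"
  shows "meager X"
proof -
  define I where "I = {cyl v K |v K. v \<in> M \<and> meager (cyl v K \<inter> X)}"
  have "B \<in> range (\<lambda>l. {w\<in>M. map (obs_seq w) [0..<length l] = l})" if "B \<in> I" for B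
  proof -
    obtain v K where "B = cyl v K" using \<open>B \<in> I\<close> by (auto simp: I_def)
    then have "B = {w\<in>M. map (obs_seq w) [0..<length (map (obs_seq v) [0..<K])] = map (obs_seq v) [0..<K]}"
      by (auto simp: cyl_def)
    then show ?thesis by blast
  qed
  then have "I \<subseteq> range (\<lambda>l. {w\<in>M. map (obs_seq w) [0..<length l] = l})" by blast
  then have "countable I" by (rule countable_subset) simp
  then have m: "meager (\<Union>B\<in>I. B \<inter> X)" by (rule meager_UN_countable) (auto simp: I_def)
  have "nowhere_dense (X - \<Union>I)" unfolding nowhere_dense_def
  proof (intro ballI allI)
    fix u N assume "u \<in> M"
    then obtain v K where "v \<in> cyl u N" "K \<ge> N" "meager (cyl v K \<inter> X)" using assms by blast
    moreover have "cyl v K \<in> I" using calculation cyl_M I_def by blast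
    ultimately show "\<exists>v\<in>cyl u N. \<exists>K\<ge>N. cyl v K \<inter> (X - \<Union>I) = {}" by blast
  qed
  then have "meager ((\<Union>B\<in>I. B \<inter> X) \<union> (X - \<Union>I))" using m meager_Un meager_nowhere_dense by blast
  then show ?thesis by (rule meager_subset) auto
qed

text \<open>A form of the Baire property that is visibly symmetric under complements.\<close>

definition decided :: "'z set \<Rightarrow> bool" where
  "decided X \<longleftrightarrow> (\<forall>u\<in>M. \<forall>N. \<exists>v\<in>cyl u N. \<exists>K\<ge>N. meager (cyl v K \<inter> X) \<or> meager (cyl v K - X))"

lemma decided_cong: "decided X \<Longrightarrow> X \<inter> M = Y \<inter> M \<Longrightarrow> decided Y"
proof -
  assume X: "decided X" "X \<inter> M = Y \<inter> M"
  have "cyl v K \<inter> X = cyl v K \<inter> Y" "cyl v K - X = cyl v K - Y" for v K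
    using X(2) cyl_M by blast+
  then show ?thesis using X by (simp add: decided_def)
qed

lemma decided_Compl: "decided X \<Longrightarrow> decided (- X)"
  by (simp add: decided_def Diff_eq disj_commute)

text \<open>If no cylinder inside \<open>W\<close> had a meager remainder, decidedness would inside
  \<open>W\<close> always yield its other alternative, and \<open>meager_locally\<close> would make
  \<open>W \<inter> X\<close> meager.\<close>

lemma comeager_cyl:
  assumes X: "decided X" and W: "is_open W" and n: "\<not> meager (W \<inter> X)"
  shows "\<exists>v\<in>W \<inter> M. \<exists>K. cyl v K \<subseteq> W \<and> meager (cyl v K - X)"
proof (rule ccontr)
  assume neg: "\<not> ?thesis"
  have "meager (W \<inter> X)"
  proof (rule meager_locally)
    fix u N assume u: "u \<in> M"
    show "\<exists>v\<in>cyl u N. \<exists>K\<ge>N. meager (cyl v K \<inter> (W \<inter> X))"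
    proof (cases "cyl u N \<inter> W = {}")
      case True
      then have "cyl u N \<inter> (W \<inter> X) = {}" by blast
      then show ?thesis using cyl_self[OF u] meager_empty by (metis order_refl)
    next
      case False
      then obtain v where v: "v \<in> cyl u N" "v \<in> W" by blast
      then obtain L where L: "cyl v L \<subseteq> W" using W cyl_M unfolding is_open_def by blast
      obtain w K where w: "w \<in> cyl v (max N L)" "K \<ge> max N L"
        "meager (cyl w K \<inter> X) \<or> meager (cyl w K - X)"
        using X v(1) cyl_M unfolding decided_def by blast
      have sub: "cyl w K \<subseteq> W"
        using L cyl_sub[OF w(1,2)] cyl_mono[of L "max N L" v] by auto
      have "\<not> meager (cyl w K - X)" using neg sub cyl_self[OF cyl_M[OF w(1)]] cyl_M[OF w(1)] by blast
      then have "meager (cyl w K \<inter> (W \<inter> X))" using w(3) meager_subset by blast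
      moreover have "w \<in> cyl u N" using w v(1) cyl_sub[of v u N "max N L"] by auto
      ultimately show ?thesis using w(2) by (meson max.boundedE)
    qed
  qed
  then show False using n by blast
qed

lemma decided_is_open: assumes "is_open X" shows "decided X"
  unfolding decided_def
proof (intro ballI allI)
  fix u N assume u: "u \<in> M"
  show "\<exists>v\<in>cyl u N. \<exists>K\<ge>N. meager (cyl v K \<inter> X) \<or> meager (cyl v K - X)"
  proof (cases "cyl u N \<inter> X = {}")
    case True then show ?thesis using cyl_self[OF u] meager_empty by (metis order_refl)
  next
    case False
    then obtain v where v: "v \<in> cyl u N" "v \<in> X" by blast
    then obtain L where L: "cyl v L \<subseteq> X" using assms cyl_M unfolding is_open_def by blast
    then have "cyl v (max N L) - X = {}" using cyl_mono[of L "max N L" v] by auto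
    then show ?thesis using v(1) meager_empty by (metis max.cobounded1)
  qed
qed

lemma decided_UN:
  fixes X :: "nat \<Rightarrow> 'z set"
  assumes "\<And>n. decided (X n)" shows "decided (\<Union>n. X n)"
  unfolding decided_def
proof (intro ballI allI)
  fix u N assume u: "u \<in> M"
  show "\<exists>v\<in>cyl u N. \<exists>K\<ge>N. meager (cyl v K \<inter> (\<Union>n. X n)) \<or> meager (cyl v K - (\<Union>n. X n))"
  proof (cases "\<forall>n. meager (cyl u N \<inter> X n)")
    case True
    then have "meager (\<Union>n. cyl u N \<inter> X n)" by (intro meager_UN) auto
    then show ?thesis using cyl_self[OF u] by (metis Int_UN_distrib order_refl)
  next
    case False
    then obtain n v K where v: "v \<in> cyl u N" "meager (cyl v K - X n)"
      using comeager_cyl[OF assms is_open_cyl] by blast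
    then have "meager (cyl v (max N K) - (\<Union>n. X n))"
      using cyl_mono[of K "max N K" v] by (elim meager_subset) auto
    then show ?thesis using v(1) by (metis max.cobounded1)
  qed
qed

text \<open>Homeomorphisms preserve meagerness; for an involution the single continuity hypothesis
  covers both directions.\<close>

lemma meager_vimage_involution:
  assumes inv: "\<And>v. v \<in> M \<Longrightarrow> f v \<in> M" "\<And>v. v \<in> M \<Longrightarrow> f (f v) = v"
    and cont: "\<And>v N. v \<in> M \<Longrightarrow> \<exists>K. \<forall>w\<in>cyl v K. f w \<in> cyl (f v) N"
    and X: "meager X"
  shows "meager (f -` X)"
proof -
  have nowhere_dense: "nowhere_dense (f -` C)" if C: "nowhere_dense C" for C
    unfolding nowhere_dense_def
  proof (intro ballI allI)
    fix u N assume u: "u \<in> M"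
    obtain K where K: "\<forall>w\<in>cyl (f u) K. f w \<in> cyl u N"
      using cont[OF inv(1)[OF u], of N] inv(2)[OF u] by auto
    obtain v L where v: "v \<in> cyl (f u) K" "cyl v L \<inter> C = {}"
      using C inv(1)[OF u] unfolding nowhere_dense_def by blast
    note vM = cyl_M[OF v(1)]
    obtain J where J: "\<forall>w\<in>cyl (f v) J. f w \<in> cyl v L"
      using cont[OF inv(1)[OF vM], of L] inv(2)[OF vM] by auto
    moreover have "cyl (f v) (max J N) \<subseteq> cyl (f v) J" by (rule cyl_mono) simp
    ultimately have "cyl (f v) (max J N) \<inter> f -` C = {}" using v(2) by blast
    moreover have "f v \<in> cyl u N" using K v(1) by blast
    ultimately show "\<exists>v\<in>cyl u N. \<exists>K\<ge>N. cyl v K \<inter> f -` C = {}" by (meson max.cobounded2)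
  qed
  obtain C :: "nat \<Rightarrow> 'z set" where C: "\<And>n. nowhere_dense (C n)" "X \<inter> M \<subseteq> (\<Union>n. C n)"
    using X unfolding meager_def by blast
  have "f -` X \<inter> M \<subseteq> (\<Union>n. f -` C n)" using C(2) inv(1) by blast
  then show ?thesis unfolding meager_def using nowhere_dense[OF C(1)] by (intro exI[of _ "\<lambda>n. f -` C n"]) auto
qed

end

section \<open>Ranked truth and evidence\<close>

text \<open>A string, the number of a statement there, and the path from the root of that statement
  to the node, last step first.\<close>

type_synonym node = "bool list \<times> nat \<times> nat list"
type_synonym point = "(nat \<Rightarrow> bool) \<times> (nat \<Rightarrow> bool)"

text \<open>
  Observations of a point \<open>(i, x)\<close>: bits of \<open>i\<close> and of \<open>x\<close>, evidence for or against a node at a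
  rank, and the least true statement at a string.
\<close>

datatype idx = Ib nat | Xb nat | Wt nat node | Rt "bool list"

instance idx :: countable by countable_datatype

definition label :: "(nat \<Rightarrow> bool) \<Rightarrow> bool list \<Rightarrow> nat \<Rightarrow> bool" where
  "label x s n = x (to_nat (Inl (s, n) :: (bool list \<times> nat) + (node \<times> nat)))"

definition leaf_at :: "(nat \<Rightarrow> bool) \<Rightarrow> node \<Rightarrow> nat \<Rightarrow> bool" where
  "leaf_at x A j = x (to_nat (Inr (A, j) :: (bool list \<times> nat) + (node \<times> nat)))"

text \<open>The number of a child determines its rank, and each rank belongs to infinitely many
  numbers, so a fresh child of any given rank is always available.\<close>

definition child_rank :: "nat \<Rightarrow> nat" where
  "child_rank j = fst (prod_decode j)"

definition child :: "node \<Rightarrow> nat \<Rightarrow> node" where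
  "child A j = (fst A, fst (snd A), j # snd (snd A))"

definition on_branch :: "(nat \<Rightarrow> bool) \<Rightarrow> bool list \<Rightarrow> bool" where
  "on_branch i s \<longleftrightarrow> (\<forall>k<length s. s ! k = i k)"

text \<open>The conditions defining \<open>F\<close> speak only of the truth of visible statements.
  Visibility depends on the root of a node alone, so evidence for a visible node stays among visible
  nodes.\<close>

definition visible :: "point \<Rightarrow> node \<Rightarrow> bool" where
  "visible z A \<longleftrightarrow> \<not> on_branch (fst z) (fst A) \<or> label (snd z) (fst A) (fst (snd A)) \<noteq> fst z (length (fst A))"

lemma visible_child [simp]: "visible z (child A j) = visible z A"
  by (simp add: visible_def child_def)

lemma Least_cong_upto:
  fixes P :: "nat \<Rightarrow> bool"
  assumes "P n" "\<And>m. m \<le> n \<Longrightarrow> P m = Q m" shows "Least P = Least Q"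
proof -
  have le: "Least P \<le> n" "P (Least P)" using assms(1) by (auto intro: Least_le LeastI)
  show ?thesis
  proof (rule Least_equality[symmetric])
    show "Q (Least P)" using assms(2) le by blast
    show "Least P \<le> m" if "Q m" for m
      using assms(2)[of m] that le(1) Least_le[of P m] by (cases "m \<le> n") auto
  qed
qed

locale ranks =
  fixes lt :: "nat \<Rightarrow> nat \<Rightarrow> bool" and a :: nat
  assumes wf_lt: "wf {(c, d). lt c d}"
    and lt_trans: "lt c d \<Longrightarrow> lt d e \<Longrightarrow> lt c e"
    and lt_total: "lt c d \<or> c = d \<or> lt d c"
begin

lemma lt_irrefl: "\<not> lt c c"
  using wf_lt wf_not_refl by fastforce

lemma lt_asym: "lt c d \<Longrightarrow> \<not> lt d c"
  using lt_trans lt_irrefl by blast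

lemma lt_induct: "(\<And>c. (\<And>d. lt d c \<Longrightarrow> P d) \<Longrightarrow> P c) \<Longrightarrow> P c"
  using wf_induct_rule[OF wf_lt, of P c] by auto

text \<open>
  If \<open>c\<close> has order type \<open>\<beta>\<close> below it, truth at rank \<open>c\<close> is a condition of class
  \<open>\<Pi>\<^sup>0\<close> with index \<open>1 + \<beta>\<close>.  Truth is antitone in the rank, and a false node has a finite piece of evidence:
  a leaf, or a true child of lower rank.
\<close>

function true_at :: "(nat \<Rightarrow> bool) \<Rightarrow> nat \<Rightarrow> node \<Rightarrow> bool" where
  "true_at x c A \<longleftrightarrow> (\<forall>j. \<not> leaf_at x A j \<and> (lt (child_rank j) c \<longrightarrow> \<not> true_at x (child_rank j) (child A j)))"
  by auto
termination
  by (relation "inv_image {(c, d). lt c d} (\<lambda>(x, c, A). c)") (use wf_lt in auto)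

declare true_at.simps [simp del]

definition evidence :: "(nat \<Rightarrow> bool) \<Rightarrow> nat \<Rightarrow> node \<Rightarrow> nat \<Rightarrow> bool" where
  "evidence x c A j \<longleftrightarrow> leaf_at x A j \<or> lt (child_rank j) c \<and> true_at x (child_rank j) (child A j)"

lemma true_at_iff_evidence: "true_at x c A \<longleftrightarrow> (\<forall>j. \<not> evidence x c A j)"
  unfolding evidence_def by (subst true_at.simps) blast

lemma true_at_mono: "true_at x c A \<Longrightarrow> \<not> lt c d \<Longrightarrow> true_at x d A"
proof -
  assume t: "true_at x c A" and cd: "\<not> lt c d"
  have "lt e c" if "lt e d" for e using lt_trans[OF that] lt_total[of c d] cd that by auto
  then have "evidence x c A j" if "evidence x d A j" for j using that by (auto simp: evidence_def)
  then show ?thesis using t true_at_iff_evidence[of x c A] true_at_iff_evidence[of x d A] by blast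
qed

abbreviation T :: "(nat \<Rightarrow> bool) \<Rightarrow> bool list \<Rightarrow> nat \<Rightarrow> bool" where
  "T x s n \<equiv> true_at x a (s, n, [])"

definition F :: "point set" where
  "F = {z. (\<forall>s n. on_branch (fst z) s \<and> T (snd z) s n \<longrightarrow> label (snd z) s n = fst z (length s))
         \<and> (\<forall>s. \<not> on_branch (fst z) s \<longrightarrow> (\<exists>n. T (snd z) s n)
           \<and> (\<forall>n m. T (snd z) s n \<and> T (snd z) s m \<longrightarrow> label (snd z) s n = label (snd z) s m))}"

text \<open>True statements at all strings but \<open>s0\<close> make both branches readable from
  the labels in \<open>x\<close>, once the bit after \<open>s0\<close> is given.\<close>

definition G :: "bool list \<Rightarrow> point set" where
  "G s0 = {z\<in>F. on_branch (fst z) s0 \<and> (\<forall>n. \<not> T (snd z) s0 n) \<and> (\<forall>s. s \<noteq> s0 \<longrightarrow> (\<exists>n. T (snd z) s n))}"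

text \<open>
  \<open>D\<close> is the set of ranks at which also the invisible nodes are observed, and \<open>E\<close> a set of
  strings whose least true statement is observed even if they are on the branch.  Truth is
  coded by 1 and evidence \<open>j\<close> against it by \<open>j + 2\<close>.
\<close>

definition obs :: "nat set \<Rightarrow> bool list set \<Rightarrow> point \<Rightarrow> idx \<Rightarrow> nat" where
  "obs D E z p = (case p of
      Ib k \<Rightarrow> of_bool (fst z k)
    | Xb k \<Rightarrow> of_bool (snd z k)
    | Wt c A \<Rightarrow> if visible z A \<or> c \<in> D
        then (if true_at (snd z) c A then 1 else Suc (Suc (LEAST j. evidence (snd z) c A j))) else 0
    | Rt s \<Rightarrow> if \<not> on_branch (fst z) s \<or> s \<in> E then LEAST n. T (snd z) s n else 0)"

text \<open>Evidence against a node may be a true child of lower rank, so a known truth value can be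
  checked in a limit only if the truth of such children is known too.\<close>

definition down_closed :: "nat set \<Rightarrow> bool" where
  "down_closed D \<longleftrightarrow> (\<forall>c\<in>D. \<forall>d. lt d c \<longrightarrow> d \<in> D)"

lemma eventually_on_branch:
  assumes "\<And>m. \<forall>\<^sub>F k in sequentially. fst (z k) m = i m"
  shows "\<forall>\<^sub>F k in sequentially. on_branch (fst (z k)) s = on_branch i s"
proof -
  have "\<forall>\<^sub>F k in sequentially. \<forall>m\<in>{..<length s}. fst (z k) m = i m"
    using assms by (intro eventually_ball_finite) auto
  then show ?thesis by eventually_elim (auto simp: on_branch_def)
qed

text \<open>Induction on the rank: evidence refers to lower ranks, where truth already converges. A
  limit value 1 excludes each single piece of evidence; a limit value \<open>j + 2\<close> fixes the
  least piece, which depends on finitely many truth values.\<close>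

lemma limit_truth:
  fixes z :: "nat \<Rightarrow> point" and g :: "idx \<Rightarrow> nat"
  assumes g: "\<And>p. \<forall>\<^sub>F k in sequentially. obs D E (z k) p = g p" and D: "down_closed D"
  defines "w \<equiv> (\<lambda>m. g (Ib m) = 1, \<lambda>m. g (Xb m) = 1)"
  shows "\<forall>\<^sub>F k in sequentially. fst (z k) m = fst w m"
    and "\<forall>\<^sub>F k in sequentially. snd (z k) m = snd w m"
    and "\<forall>\<^sub>F k in sequentially. visible (z k) A = visible w A"
    and "visible w A \<or> c \<in> D \<Longrightarrow> g (Wt c A) = obs D E w (Wt c A)"
    and "visible w A \<or> c \<in> D \<Longrightarrow> \<forall>\<^sub>F k in sequentially. true_at (snd (z k)) c A = true_at (snd w) c A"
proof -
  show i: "\<forall>\<^sub>F k in sequentially. fst (z k) m = fst w m" for m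
    using g[of "Ib m"] by eventually_elim (auto simp: obs_def w_def of_bool_def split: if_splits)
  show x: "\<forall>\<^sub>F k in sequentially. snd (z k) m = snd w m" for m
    using g[of "Xb m"] by eventually_elim (auto simp: obs_def w_def of_bool_def split: if_splits)
  show v: "\<forall>\<^sub>F k in sequentially. visible (z k) A = visible w A" for A
    using eventually_on_branch[OF i, of "fst A"] i[of "length (fst A)"]
      x[of "to_nat (Inl (fst A, fst (snd A)) :: (bool list \<times> nat) + (node \<times> nat))"]
    by eventually_elim (simp add: visible_def label_def)
  have leaf_at: "\<forall>\<^sub>F k in sequentially. leaf_at (snd (z k)) A j = leaf_at (snd w) A j" for A j
    using x by (simp add: leaf_at_def)
  have "\<forall>A. visible w A \<or> c \<in> D \<longrightarrow> g (Wt c A) = obs D E w (Wt c A)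
      \<and> (\<forall>\<^sub>F k in sequentially. true_at (snd (z k)) c A = true_at (snd w) c A)" for c
  proof (induction c rule: lt_induct)
    case (1 c)
    show ?case
    proof (intro allI impI)
      fix A assume kn: "visible w A \<or> c \<in> D"
      have evidence: "\<forall>\<^sub>F k in sequentially. evidence (snd (z k)) c A j = evidence (snd w) c A j" for j
      proof (cases "lt (child_rank j) c")
        case True
        then have "visible w (child A j) \<or> child_rank j \<in> D" using kn D by (auto simp: down_closed_def)
        then have "\<forall>\<^sub>F k in sequentially. true_at (snd (z k)) (child_rank j) (child A j) = true_at (snd w) (child_rank j) (child A j)"
          using 1[OF True] by blast
        then show ?thesis using leaf_at[of A j] by eventually_elim (simp add: evidence_def)
      next
        case False then show ?thesis using leaf_at[of A j] by (simp add: evidence_def)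
      qed
      have known: "\<forall>\<^sub>F k in sequentially. g (Wt c A) =
          (if true_at (snd (z k)) c A then 1 else Suc (Suc (LEAST j. evidence (snd (z k)) c A j)))"
        using g[of "Wt c A"] v[of A] by eventually_elim (use kn in \<open>auto simp: obs_def\<close>)
      show "g (Wt c A) = obs D E w (Wt c A)
        \<and> (\<forall>\<^sub>F k in sequentially. true_at (snd (z k)) c A = true_at (snd w) c A)"
      proof (cases "g (Wt c A) = 1")
        case True
        then have t: "\<forall>\<^sub>F k in sequentially. true_at (snd (z k)) c A"
          using known by (auto elim: eventually_mono split: if_splits)
        have "\<not> evidence (snd w) c A j" for j
        proof -
          have "\<forall>\<^sub>F k in sequentially. \<not> evidence (snd w) c A j"
            using t evidence[of j] by eventually_elim (auto simp: true_at_iff_evidence)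
          then show ?thesis by simp
        qed
        then have "true_at (snd w) c A" by (simp add: true_at_iff_evidence)
        then show ?thesis using t True kn by (auto simp: obs_def)
      next
        case False
        define j where "j = g (Wt c A) - 2"
        have nt: "\<forall>\<^sub>F k in sequentially. \<not> true_at (snd (z k)) c A \<and> g (Wt c A) = Suc (Suc j)
             \<and> (LEAST j. evidence (snd (z k)) c A j) = j"
          using known by eventually_elim (use False in \<open>auto simp: j_def split: if_splits\<close>)
        have "\<forall>\<^sub>F k in sequentially. \<forall>m\<in>{..j}. evidence (snd (z k)) c A m = evidence (snd w) c A m"
          using evidence by (intro eventually_ball_finite) auto
        then have "\<forall>\<^sub>F k in sequentially. evidence (snd w) c A j \<and> (LEAST j. evidence (snd w) c A j) = j"
          using nt
        proof eventually_elim
          case (elim k)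
          then obtain m where "evidence (snd (z k)) c A m" by (auto simp: true_at_iff_evidence)
          then have e: "evidence (snd (z k)) c A j" using elim(2) LeastI by metis
          then have "(LEAST j. evidence (snd (z k)) c A j) = (LEAST j. evidence (snd w) c A j)"
            by (rule Least_cong_upto) (use elim(1) in auto)
          then show ?case using e elim by simp
        qed
        then have "evidence (snd w) c A j" "(LEAST j. evidence (snd w) c A j) = j" by simp_all
        moreover have "g (Wt c A) = Suc (Suc j)" using nt by (simp add: eventually_conj_iff)
        moreover have "\<not> true_at (snd w) c A" using calculation by (auto simp: true_at_iff_evidence)
        ultimately show ?thesis using nt kn by (auto simp: obs_def elim: eventually_mono)
      qed
    qed
  qed
  then show "visible w A \<or> c \<in> D \<Longrightarrow> g (Wt c A) = obs D E w (Wt c A)"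
    and "visible w A \<or> c \<in> D \<Longrightarrow> \<forall>\<^sub>F k in sequentially. true_at (snd (z k)) c A = true_at (snd w) c A" by blast+
qed

text \<open>The recorded least true statement prevents existence from getting lost in the limit. A
  string of \<open>E\<close> may lie on the branch, where its statements can be invisible; with
  \<open>D = UNIV\<close> they are observed nevertheless.\<close>

lemma limit_in_F:
  fixes z :: "nat \<Rightarrow> point" and g :: "idx \<Rightarrow> nat"
  assumes g: "\<And>p. \<forall>\<^sub>F k in sequentially. obs D E (z k) p = g p" and D: "down_closed D"
    and ED: "E = {} \<or> D = UNIV"
    and zF: "\<And>k. z k \<in> F" and zE: "\<And>k s. s \<in> E \<Longrightarrow> \<exists>n. T (snd (z k)) s n"
  defines "w \<equiv> (\<lambda>m. g (Ib m) = 1, \<lambda>m. g (Xb m) = 1)"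
  shows "w \<in> F" and "\<And>s. s \<in> E \<Longrightarrow> \<exists>n. T (snd w) s n" and "obs D E w = g"
proof -
  note lim = limit_truth[OF g D, folded w_def]
  have on_branch: "\<forall>\<^sub>F k in sequentially. on_branch (fst (z k)) s = on_branch (fst w) s" for s
    by (rule eventually_on_branch[OF lim(1)])
  have root: "(\<exists>n. T (snd w) s n) \<and> g (Rt s) = (LEAST n. T (snd w) s n)" if s: "\<not> on_branch (fst w) s \<or> s \<in> E" for s
  proof -
    have kn: "visible w (s, n, []) \<or> a \<in> D" for n using s ED by (auto simp: visible_def)
    have "\<forall>\<^sub>F k in sequentially. T (snd (z k)) s (g (Rt s)) \<and> (LEAST n. T (snd (z k)) s n) = g (Rt s)"
      using g[of "Rt s"] on_branch[of s]
    proof eventually_elim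
      case (elim k)
      then have s': "\<not> on_branch (fst (z k)) s \<or> s \<in> E" using s by simp
      then have "\<exists>n. T (snd (z k)) s n" using zF[of k] zE[of s k] unfolding F_def by blast
      then have "T (snd (z k)) s (LEAST n. T (snd (z k)) s n)" by (rule LeastI_ex)
      moreover have "g (Rt s) = (LEAST n. T (snd (z k)) s n)" using elim(1) s' by (auto simp: obs_def)
      ultimately show ?case by simp
    qed
    moreover have "\<forall>\<^sub>F k in sequentially. \<forall>n\<in>{..g (Rt s)}. T (snd (z k)) s n = T (snd w) s n"
      using lim(5)[OF kn] by (intro eventually_ball_finite) auto
    ultimately have "\<forall>\<^sub>F k in sequentially. T (snd w) s (g (Rt s)) \<and> g (Rt s) = (LEAST n. T (snd w) s n)"
    proof eventually_elim
      case (elim k)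
      then have "(LEAST n. T (snd (z k)) s n) = (LEAST n. T (snd w) s n)"
        by (intro Least_cong_upto[of _ "g (Rt s)"]) auto
      then show ?case using elim by simp
    qed
    then show ?thesis by auto
  qed
  show E: "\<And>s. s \<in> E \<Longrightarrow> \<exists>n. T (snd w) s n" using root by blast
  have "label (snd w) s n = fst w (length s)" if "on_branch (fst w) s" "T (snd w) s n" for s n
  proof (rule ccontr)
    \<comment> \<open>A wrong label makes the statement visible, so it would already be true, and
      wrong, along the sequence.\<close>
    assume wrong: "\<not> ?thesis"
    then have v: "visible w (s, n, [])" by (simp add: visible_def)
    have "\<forall>\<^sub>F k in sequentially. False"
      using lim(5)[OF disjI1[OF v], of a] lim(3)[of "(s, n, [])"] on_branch[of s]
    proof eventually_elim
      case (elim k)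
      then have "T (snd (z k)) s n" "on_branch (fst (z k)) s" "visible (z k) (s, n, [])" using that v by auto
      then show ?case using zF[of k] by (auto simp: F_def visible_def)
    qed
    then show False by simp
  qed
  moreover have "label (snd w) s n = label (snd w) s m"
    if s: "\<not> on_branch (fst w) s" and t: "T (snd w) s n" "T (snd w) s m" for s n m
  proof -
    have v: "visible w (s, k, [])" for k using s by (simp add: visible_def)
    have label: "\<forall>\<^sub>F k in sequentially. label (snd (z k)) s m = label (snd w) s m" for m
      using lim(2) by (simp add: label_def)
    have "\<forall>\<^sub>F k in sequentially. label (snd w) s n = label (snd w) s m"
      using lim(5)[OF disjI1[OF v[of n]], of a] lim(5)[OF disjI1[OF v[of m]], of a] on_branch[of s] label[of n] label[of m]
    proof eventually_elim
      case (elim k)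
      then have "T (snd (z k)) s n" "T (snd (z k)) s m" "\<not> on_branch (fst (z k)) s" using s t by auto
      then have "label (snd (z k)) s n = label (snd (z k)) s m" using zF[of k] unfolding F_def by blast
      then show ?case using elim by simp
    qed
    then show ?thesis by simp
  qed
  ultimately show "w \<in> F" using root unfolding F_def by blast
  show "obs D E w = g"
  proof
    fix p
    have "\<forall>\<^sub>F k in sequentially. obs D E w p = g p"
    proof (cases p)
      case (Ib m)
      show ?thesis using g[of p] lim(1)[of m] by eventually_elim (auto simp: obs_def Ib)
    next
      case (Xb m)
      show ?thesis using g[of p] lim(2)[of m] by eventually_elim (auto simp: obs_def Xb)
    next
      case (Wt c A)
      show ?thesis
      proof (cases "visible w A \<or> c \<in> D")
        case True then show ?thesis using lim(4)[OF True] Wt by simp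
      next
        case False
        show ?thesis using g[of p] lim(3)[of A] by eventually_elim (use False in \<open>auto simp: obs_def Wt\<close>)
      qed
    next
      case (Rt s)
      show ?thesis
      proof (cases "\<not> on_branch (fst w) s \<or> s \<in> E")
        case True then show ?thesis using root Rt by (auto simp: obs_def)
      next
        case False
        show ?thesis using g[of p] on_branch[of s] by eventually_elim (use False in \<open>auto simp: obs_def Rt\<close>)
      qed
    qed
    then show "obs D E w p = g p" by simp
  qed
qed

definition obs_seq :: "nat set \<Rightarrow> bool list set \<Rightarrow> point \<Rightarrow> nat \<Rightarrow> nat" where
  "obs_seq D E z k = obs D E z (from_nat k)"

lemma obs_seq_limit:
  assumes "\<And>p. \<forall>\<^sub>F k in sequentially. obs_seq D E (z k) p = g p"
  shows "\<forall>\<^sub>F k in sequentially. obs D E (z k) p = g (to_nat p)"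
  using assms[of "to_nat p"] by (simp add: obs_seq_def)

end

section \<open>Neighbourhoods given by finitely many true facts\<close>

context ranks
begin

text \<open>
  The known true facts about \<open>u\<close> with small code persist; for invisible nodes the rank \<open>c\<close> of such
  a fact is first lowered to \<open>t c\<close>.
\<close>

definition nbhd :: "nat set \<Rightarrow> (nat \<Rightarrow> nat) \<Rightarrow> point \<Rightarrow> nat \<Rightarrow> point set" where
  "nbhd D t u N = {v. (\<forall>k<N. fst v k = fst u k \<and> snd v k = snd u k)
      \<and> (\<forall>c A. to_nat (c, A) < N \<longrightarrow> visible v A = visible u A \<and> (true_at (snd u) c A \<longrightarrow>
          (visible u A \<longrightarrow> true_at (snd v) c A) \<and> (c \<in> D \<longrightarrow> \<not> visible u A \<longrightarrow> true_at (snd v) (t c) A)))}"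

lemma nbD:
  assumes "v \<in> nbhd D t u N"
  shows "k < N \<Longrightarrow> fst v k = fst u k" "k < N \<Longrightarrow> snd v k = snd u k"
    and "to_nat (c, A) < N \<Longrightarrow> visible v A = visible u A"
    and "to_nat (c, A) < N \<Longrightarrow> true_at (snd u) c A \<Longrightarrow> visible u A \<Longrightarrow> true_at (snd v) c A"
    and "to_nat (c, A) < N \<Longrightarrow> true_at (snd u) c A \<Longrightarrow> c \<in> D \<Longrightarrow> \<not> visible u A \<Longrightarrow> true_at (snd v) (t c) A"
  using assms unfolding nbhd_def by blast+

text \<open>Only true facts are listed in \<open>nbhd\<close>, but falsity persists as well: it is
  due to a leaf, which is a bit of \<open>x\<close>, or to a true child of lower rank, which is
  known too.\<close>

lemma nbhd_truth:
  assumes D: "down_closed D"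
  shows "visible u A \<or> c \<in> D \<Longrightarrow> \<forall>\<^sub>F N in sequentially. \<forall>v\<in>nbhd D (\<lambda>c. c) u N. true_at (snd v) c A = true_at (snd u) c A"
proof (induction c arbitrary: A rule: lt_induct)
  case (1 c)
  show ?case
  proof (cases "true_at (snd u) c A")
    case True
    have "\<forall>\<^sub>F N in sequentially. to_nat (c, A) < N" by (rule eventually_gt_at_top)
    then show ?thesis using True 1(2) nbD(4,5)[of _ D "\<lambda>c. c" u _ c A]
      by (elim eventually_mono) blast
  next
    case False
    then obtain j where "evidence (snd u) c A j" by (auto simp: true_at_iff_evidence)
    then consider "leaf_at (snd u) A j" | "lt (child_rank j) c" "true_at (snd u) (child_rank j) (child A j)" by (auto simp: evidence_def)
    then have "\<forall>\<^sub>F N in sequentially. \<forall>v\<in>nbhd D (\<lambda>c. c) u N. evidence (snd v) c A j"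
    proof cases
      case 1
      have "\<forall>\<^sub>F N in sequentially. to_nat (Inr (A, j) :: (bool list \<times> nat) + (node \<times> nat)) < N"
        by (rule eventually_gt_at_top)
      then show ?thesis by eventually_elim (use 1 in \<open>auto simp: nbhd_def leaf_at_def evidence_def\<close>)
    next
      case 2
      then have "visible u (child A j) \<or> child_rank j \<in> D" using 1(2) D by (auto simp: down_closed_def)
      from 1(1)[OF 2(1) this] show ?thesis by eventually_elim (use 2 in \<open>auto simp: evidence_def\<close>)
    qed
    then show ?thesis by eventually_elim (use False in \<open>auto simp: true_at_iff_evidence\<close>)
  qed
qed

lemma nbhd_on_branch: "\<forall>\<^sub>F N in sequentially. \<forall>v\<in>nbhd D t u N. on_branch (fst v) s = on_branch (fst u) s"
  using eventually_ge_at_top[of "length s"] by eventually_elim (auto simp: nbhd_def on_branch_def)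

lemma nbhd_visible: "\<forall>\<^sub>F N in sequentially. \<forall>v\<in>nbhd D t u N. visible v A = visible u A"
proof -
  have "\<forall>\<^sub>F N in sequentially. to_nat (0 :: nat, A) < N" by (rule eventually_gt_at_top)
  then show ?thesis by (rule eventually_mono) (use nbD(3) in blast)
qed

lemma nbhd_obs:
  assumes D: "down_closed D" and ED: "E = {} \<or> D = UNIV"
    and uF: "u \<in> F" and uE: "\<And>s. s \<in> E \<Longrightarrow> \<exists>n. T (snd u) s n"
  shows "\<forall>\<^sub>F N in sequentially. \<forall>v\<in>nbhd D (\<lambda>c. c) u N. obs D E v p = obs D E u p"
proof (cases p)
  case (Ib k)
  show ?thesis using eventually_gt_at_top[of k] by eventually_elim (auto simp: nbhd_def obs_def Ib)
next
  case (Xb k)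
  show ?thesis using eventually_gt_at_top[of k] by eventually_elim (auto simp: nbhd_def obs_def Xb)
next
  case (Wt c A)
  show ?thesis
  proof (cases "visible u A \<or> c \<in> D")
    case False
    show ?thesis using nbhd_visible by eventually_elim (use False in \<open>auto simp: obs_def Wt\<close>)
  next
    case kn: True
    have evidence: "\<forall>\<^sub>F N in sequentially. \<forall>v\<in>nbhd D (\<lambda>c. c) u N. evidence (snd v) c A j = evidence (snd u) c A j" for j
    proof -
      have "\<forall>\<^sub>F N in sequentially. to_nat (Inr (A, j) :: (bool list \<times> nat) + (node \<times> nat)) < N"
        by (rule eventually_gt_at_top)
      then have l: "\<forall>\<^sub>F N in sequentially. \<forall>v\<in>nbhd D (\<lambda>c. c) u N. leaf_at (snd v) A j = leaf_at (snd u) A j"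
        by eventually_elim (auto simp: nbhd_def leaf_at_def)
      show ?thesis
      proof (cases "lt (child_rank j) c")
        case True
        then have "visible u (child A j) \<or> child_rank j \<in> D" using kn D by (auto simp: down_closed_def)
        from nbhd_truth[OF D this] l show ?thesis by eventually_elim (auto simp: evidence_def)
      next
        case False with l show ?thesis by (simp add: evidence_def)
      qed
    qed
    show ?thesis
    proof (cases "true_at (snd u) c A")
      case True
      show ?thesis using nbhd_visible nbhd_truth[OF D kn]
        by eventually_elim (use True kn in \<open>auto simp: obs_def Wt\<close>)
    next
      case False
      then obtain j where j: "evidence (snd u) c A j" by (auto simp: true_at_iff_evidence)
      have "\<forall>\<^sub>F N in sequentially. \<forall>m\<in>{..j}. \<forall>v\<in>nbhd D (\<lambda>c. c) u N. evidence (snd v) c A m = evidence (snd u) c A m"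
        using evidence by (intro eventually_ball_finite) auto
      then have "\<forall>\<^sub>F N in sequentially. \<forall>v\<in>nbhd D (\<lambda>c. c) u N.
          (LEAST j. evidence (snd u) c A j) = (LEAST j. evidence (snd v) c A j)"
        by eventually_elim (use j in \<open>auto intro!: Least_cong_upto[of _ j]\<close>)
      then show ?thesis using nbhd_visible nbhd_truth[OF D kn]
        by eventually_elim (use False kn in \<open>auto simp: obs_def Wt\<close>)
    qed
  qed
next
  case (Rt s)
  show ?thesis
  proof (cases "\<not> on_branch (fst u) s \<or> s \<in> E")
    case False
    show ?thesis using nbhd_on_branch[of D "\<lambda>c. c" u s] by eventually_elim (use False in \<open>auto simp: obs_def Rt\<close>)
  next
    case True
    then have "\<exists>n. T (snd u) s n" using uF uE unfolding F_def by blast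
    then obtain n where n: "T (snd u) s n" by blast
    have kn: "visible u (s, m, []) \<or> a \<in> D" for m using True ED by (auto simp: visible_def)
    have "\<forall>\<^sub>F N in sequentially. \<forall>m\<in>{..n}. \<forall>v\<in>nbhd D (\<lambda>c. c) u N. T (snd v) s m = T (snd u) s m"
      using nbhd_truth[OF D kn] by (intro eventually_ball_finite) auto
    then have "\<forall>\<^sub>F N in sequentially. \<forall>v\<in>nbhd D (\<lambda>c. c) u N.
        (LEAST n. T (snd u) s n) = (LEAST n. T (snd v) s n)"
      by eventually_elim (use n in \<open>auto intro!: Least_cong_upto[of _ n]\<close>)
    then show ?thesis using nbhd_on_branch[of D "\<lambda>c. c" u s] by eventually_elim (use True in \<open>auto simp: obs_def Rt\<close>)
  qed
qed

lemma nbhd_obs_seq: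
  assumes "down_closed D" "E = {} \<or> D = UNIV" "u \<in> F" "\<And>s. s \<in> E \<Longrightarrow> \<exists>n. T (snd u) s n"
  shows "\<forall>\<^sub>F N in sequentially. \<forall>v\<in>nbhd D (\<lambda>c. c) u N. \<forall>p<K. obs_seq D E v p = obs_seq D E u p"
proof -
  have "\<forall>\<^sub>F N in sequentially. \<forall>p\<in>{..<K}. \<forall>v\<in>nbhd D (\<lambda>c. c) u N. obs_seq D E v p = obs_seq D E u p"
    unfolding obs_seq_def using nbhd_obs[OF assms] by (intro eventually_ball_finite) auto
  then show ?thesis by eventually_elim auto
qed

lemma obs_seq_agree:
  assumes "finite S"
  shows "\<forall>\<^sub>F K in sequentially. \<forall>w. (\<forall>p<K. obs_seq D E w p = obs_seq D E v p) \<longrightarrow> (\<forall>p\<in>S. obs D E w p = obs D E v p)"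
proof -
  obtain K where "\<forall>k\<in>to_nat ` S. k < K" using assms finite_nat_set_iff_bounded by blast
  then have K: "to_nat p < L" if "p \<in> S" "K \<le> L" for p L using that by fastforce
  have "obs D E w p = obs D E v p" if "\<forall>p<L. obs_seq D E w p = obs_seq D E v p" "p \<in> S" "K \<le> L" for w p L
    using that(1)[rule_format, OF K[OF that(2,3)]] by (simp add: obs_seq_def)
  then show ?thesis using eventually_ge_at_top[of K] by (elim eventually_mono) blast
qed

lemma obs_seq_agree_visible:
  "\<forall>\<^sub>F K in sequentially. \<forall>w. (\<forall>p<K. obs_seq D E w p = obs_seq D E v p) \<longrightarrow> visible w A = visible v A"
proof -
  let ?S = "Ib ` {..length (fst A)}
    \<union> {Xb (to_nat (Inl (fst A, fst (snd A)) :: (bool list \<times> nat) + (node \<times> nat)))}"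
  have *: "visible w A = visible v A" if S: "\<forall>p\<in>?S. obs D E w p = obs D E v p" for w
  proof -
    have "fst w m = fst v m" if "m \<le> length (fst A)" for m
      using bspec[OF S, of "Ib m"] that by (simp add: obs_def of_bool_eq_iff)
    moreover have "label (snd w) (fst A) (fst (snd A)) = label (snd v) (fst A) (fst (snd A))"
      using S by (simp add: obs_def label_def of_bool_eq_iff)
    ultimately show ?thesis by (auto simp: visible_def on_branch_def)
  qed
  have "finite ?S" by simp
  from obs_seq_agree[OF this, of D E v] show ?thesis by (rule eventually_mono) (use * in blast)
qed

lemma obs_seq_agree_truth:
  assumes "visible v A \<or> c \<in> D"
  shows "\<forall>\<^sub>F K in sequentially. \<forall>w. (\<forall>p<K. obs_seq D E w p = obs_seq D E v p) \<longrightarrow> true_at (snd w) c A = true_at (snd v) c A"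
  using obs_seq_agree_visible[of D E v A] obs_seq_agree[of "{Wt c A}" D E v, OF finite.insertI[OF finite.emptyI]]
proof eventually_elim
  case (elim K)
  have "true_at (snd w) c A = true_at (snd v) c A" if w: "\<forall>p<K. obs_seq D E w p = obs_seq D E v p" for w
  proof -
    have "visible w A = visible v A" "obs D E w (Wt c A) = obs D E v (Wt c A)" using elim w by blast+
    then show ?thesis using assms by (auto simp: obs_def split: if_splits)
  qed
  then show ?case by blast
qed

text \<open>Lowered facts persist because their new ranks lie in \<open>D'\<close>. For
  \<open>t\<close> the identity and \<open>D' = D\<close> this complements
  \<open>nbhd_obs_seq\<close>: the sets \<open>nbhd\<close> then form a base at
  \<open>u\<close>.\<close>

lemma nbhd_open:
  assumes v: "v \<in> nbhd D t u N" and t: "\<And>c. c \<in> D \<Longrightarrow> t c \<in> D'"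
  shows "\<forall>\<^sub>F K in sequentially. \<forall>w. (\<forall>p<K. obs_seq D' E w p = obs_seq D' E v p) \<longrightarrow> w \<in> nbhd D t u N"
proof -
  have "finite (to_nat -` {..<N} :: (nat \<times> node) set)" by (rule finite_vimageI) auto
  then have fin: "finite {q :: nat \<times> node. to_nat q < N}" by (simp add: vimage_def)
  have 1: "\<forall>\<^sub>F K in sequentially. \<forall>w. (\<forall>p<K. obs_seq D' E w p = obs_seq D' E v p) \<longrightarrow>
      (\<forall>k<N. fst w k = fst v k \<and> snd w k = snd v k)"
  proof -
    have *: "finite (Ib ` {..<N} \<union> Xb ` {..<N})" by simp
    have "fst w k = fst v k \<and> snd w k = snd v k"
      if "\<forall>p\<in>Ib ` {..<N} \<union> Xb ` {..<N}. obs D' E w p = obs D' E v p" "k < N" for w k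
      using bspec[OF that(1), of "Ib k"] bspec[OF that(1), of "Xb k"] that(2)
      by (simp add: obs_def of_bool_eq_iff)
    with obs_seq_agree[OF *, of D' E v] show ?thesis by (elim eventually_mono) blast
  qed
  have "\<forall>\<^sub>F K in sequentially. \<forall>q\<in>{q. to_nat q < N}. \<forall>w. (\<forall>p<K. obs_seq D' E w p = obs_seq D' E v p) \<longrightarrow>
      visible w (snd q) = visible v (snd q) \<and> (true_at (snd u) (fst q) (snd q) \<longrightarrow>
       (visible u (snd q) \<longrightarrow> true_at (snd w) (fst q) (snd q))
         \<and> (fst q \<in> D \<longrightarrow> \<not> visible u (snd q) \<longrightarrow> true_at (snd w) (t (fst q)) (snd q)))"
  proof (rule eventually_ball_finite[OF fin], intro ballI)
    fix q assume "q \<in> {q :: nat \<times> node. to_nat q < N}"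
    then obtain c A where q: "q = (c, A)" "to_nat (c, A) < N" by (cases q) auto
    note vq = v[unfolded nbhd_def mem_Collect_eq, THEN conjunct2, rule_format, OF q(2)]
    consider "\<not> true_at (snd u) c A" | "true_at (snd u) c A" "visible u A" | "true_at (snd u) c A" "\<not> visible u A" "c \<in> D"
      | "\<not> visible u A" "c \<notin> D" by blast
    then show "\<forall>\<^sub>F K in sequentially. \<forall>w. (\<forall>p<K. obs_seq D' E w p = obs_seq D' E v p) \<longrightarrow>
      visible w (snd q) = visible v (snd q) \<and> (true_at (snd u) (fst q) (snd q) \<longrightarrow>
       (visible u (snd q) \<longrightarrow> true_at (snd w) (fst q) (snd q))
         \<and> (fst q \<in> D \<longrightarrow> \<not> visible u (snd q) \<longrightarrow> true_at (snd w) (t (fst q)) (snd q)))"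
    proof cases
      case 1
      show ?thesis using obs_seq_agree_visible[of D' E v A] by eventually_elim (use 1 q in auto)
    next
      case 2
      then have "visible v A \<or> c \<in> D'" using vq by blast
      from obs_seq_agree_truth[OF this, of E] obs_seq_agree_visible[of D' E v A]
      show ?thesis by eventually_elim (use 2 q vq in auto)
    next
      case 3
      then have "visible v A \<or> t c \<in> D'" using t by blast
      from obs_seq_agree_truth[OF this, of E] obs_seq_agree_visible[of D' E v A]
      show ?thesis by eventually_elim (use 3 q vq in auto)
    next
      case 4
      show ?thesis using obs_seq_agree_visible[of D' E v A] by eventually_elim (use 4 q in auto)
    qed
  qed
  then show ?thesis using 1
  proof eventually_elim
    case (elim K)
    show ?case
    proof (intro allI impI)
      fix w assume w: "\<forall>p<K. obs_seq D' E w p = obs_seq D' E v p"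
      have *: "fst w k = fst v k \<and> snd w k = snd v k" if "k < N" for k using elim(2) w that by blast
      have "visible w A = visible v A \<and> (true_at (snd u) c A \<longrightarrow> (visible u A \<longrightarrow> true_at (snd w) c A)
         \<and> (c \<in> D \<longrightarrow> \<not> visible u A \<longrightarrow> true_at (snd w) (t c) A))" if "to_nat (c, A) < N" for c A
        using elim(1)[rule_format, of "(c, A)" w] w that by simp
      then show "w \<in> nbhd D t u N" using v * by (simp add: nbhd_def)
    qed
  qed
qed

lemma code_space_F: assumes "down_closed D" shows "code_space F (obs_seq D {})"
proof
  fix z g assume z: "\<And>k. z k \<in> F" and g: "\<And>p. \<forall>\<^sub>F k in sequentially. obs_seq D {} (z k) p = g p"
  define w where "w = (\<lambda>m. g (to_nat (Ib m)) = 1, \<lambda>m. g (to_nat (Xb m)) = 1)"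
  note lim = limit_in_F[OF obs_seq_limit[OF g] assms, folded w_def]
  have "w \<in> F" "obs D {} w = (\<lambda>p. g (to_nat p))" using lim z by auto
  moreover have "obs_seq D {} w p = g p" for p
  proof -
    have "\<forall>\<^sub>F k in sequentially. g (to_nat (from_nat p :: idx)) = g p"
      using g[of p] obs_seq_limit[OF g, of "from_nat p"] by eventually_elim (simp add: obs_seq_def)
    then show ?thesis using calculation by (simp add: obs_seq_def)
  qed
  ultimately show "\<exists>z\<in>F. obs_seq D {} z = g" by blast
qed

text \<open>The absence of true statements at \<open>s0\<close> survives limits because all ranks,
  in particular \<open>a\<close>, are observed at all nodes.\<close>

lemma code_space_G: "code_space (G s0) (obs_seq UNIV (- {s0}))"
proof
  fix z g assume z: "\<And>k. z k \<in> G s0" and g: "\<And>p. \<forall>\<^sub>F k in sequentially. obs_seq UNIV (- {s0}) (z k) p = g p"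
  define w where "w = (\<lambda>m. g (to_nat (Ib m)) = 1, \<lambda>m. g (to_nat (Xb m)) = 1)"
  have down_closed: "down_closed UNIV" by (simp add: down_closed_def)
  note lim = limit_in_F[OF obs_seq_limit[OF g] down_closed, folded w_def]
  note tru = limit_truth[OF obs_seq_limit[OF g] down_closed, folded w_def]
  have w: "w \<in> F" "\<And>s. s \<noteq> s0 \<Longrightarrow> \<exists>n. T (snd w) s n" "obs UNIV (- {s0}) w = (\<lambda>p. g (to_nat p))"
    using lim z by (auto simp: G_def)
  have "\<forall>\<^sub>F k in sequentially. on_branch (fst w) s0"
    using eventually_on_branch[OF tru(1), of s0] by eventually_elim (use z in \<open>auto simp: G_def\<close>)
  then have "on_branch (fst w) s0" by simp
  moreover have "\<not> T (snd w) s0 n" for n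
  proof -
    have "\<forall>\<^sub>F k in sequentially. \<not> T (snd w) s0 n"
      using tru(5)[of "(s0, n, [])" a, OF disjI2[OF UNIV_I]] by eventually_elim (use z in \<open>auto simp: G_def\<close>)
    then show ?thesis by simp
  qed
  ultimately have "w \<in> G s0" using w by (auto simp: G_def)
  moreover have "obs_seq UNIV (- {s0}) w p = g p" for p
  proof -
    have "\<forall>\<^sub>F k in sequentially. g (to_nat (from_nat p :: idx)) = g p"
      using g[of p] obs_seq_limit[OF g, of "from_nat p"] by eventually_elim (simp add: obs_seq_def)
    then show ?thesis using w(3) by (simp add: obs_seq_def)
  qed
  ultimately show "\<exists>z\<in>G s0. obs_seq UNIV (- {s0}) z = g" by blast
qed

section \<open>Realizing finite sets of facts\<close>

lemma finite_lt_max: "finite S \<Longrightarrow> S \<noteq> {} \<Longrightarrow> \<exists>m\<in>S. \<forall>d\<in>S. \<not> lt m d"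
proof (induction S rule: finite_ne_induct)
  case (singleton c) then show ?case using lt_irrefl by blast
next
  case (insert c S)
  then obtain m where "m \<in> S" "\<forall>d\<in>S. \<not> lt m d" by blast
  then show ?case using lt_irrefl lt_asym lt_trans by (cases "lt m c") blast+
qed

text \<open>
  The free leaves of \<open>x'\<close> are chosen so that only the prescribed nodes and some fresh ones are
  leafless.  A fresh child of rank \<open>c\<close> makes a node false at all ranks above \<open>c\<close> without affecting
  its truth at rank \<open>c\<close>.
\<close>

lemma extension:
  fixes x :: "nat \<Rightarrow> bool" and L :: "bool list \<Rightarrow> bool" and P :: "(nat \<times> node) set" and Z0 :: "bool list set"
  assumes fin: "finite P"
    and leaf: "\<And>c A j. (c, A) \<in> P \<Longrightarrow> \<not> leaf_at x A j"
    and consistent: "\<And>c A d j. (c, A) \<in> P \<Longrightarrow> (d, child A j) \<in> P \<Longrightarrow> lt (child_rank j) c \<Longrightarrow> lt d (child_rank j)"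
    and root: "\<And>c s n. (c, (s, n, [])) \<in> P \<Longrightarrow> \<not> lt c a \<Longrightarrow> s \<notin> Z0 \<and> label x s n = L s"
  obtains x' where "\<And>k. k < K \<Longrightarrow> x' k = x k" "\<And>c A. (c, A) \<in> P \<Longrightarrow> true_at x' c A"
    "\<And>s n. T x' s n \<Longrightarrow> s \<notin> Z0 \<and> label x' s n = L s"
    "\<And>s. s \<notin> Z0 \<Longrightarrow> \<exists>n. T x' s n"
proof -
  define PN where "PN = snd ` P"
  have "\<exists>c. (c, A) \<in> P \<and> (\<forall>d. (d, A) \<in> P \<longrightarrow> \<not> lt c d)" if "A \<in> PN" for A
  proof -
    have "{c. (c, A) \<in> P} \<subseteq> fst ` P" by force
    then have "finite {c. (c, A) \<in> P}" using fin finite_subset by blast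
    moreover have "{c. (c, A) \<in> P} \<noteq> {}" using that by (auto simp: PN_def)
    ultimately show ?thesis using finite_lt_max[of "{c. (c, A) \<in> P}"] by blast
  qed
  \<comment> \<open>\<open>rho A\<close> is the largest rank prescribed for \<open>A\<close>; truth
    there implies the other facts prescribed for \<open>A\<close>.\<close>
  then obtain rho where rho: "\<And>A. A \<in> PN \<Longrightarrow> (rho A, A) \<in> P"
    "\<And>A d. (d, A) \<in> P \<Longrightarrow> \<not> lt (rho A) d" by (metis PN_def image_eqI snd_conv)
  let ?co = "to_nat :: (bool list \<times> nat) + (node \<times> nat) \<Rightarrow> nat"
  define Q where "Q = {q. ?co q < K}"
  have "finite (?co -` {..<K})" by (rule finite_vimageI) auto
  then have finQ: "finite Q" by (simp add: Q_def vimage_def)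
  define Nodes where "Nodes = PN \<union> {A. \<exists>j. Inr (A, j) \<in> Q}"
  have "Nodes \<subseteq> PN \<union> (\<lambda>q. case q of Inl b \<Rightarrow> undefined | Inr (A, j) \<Rightarrow> A) ` Q"
    by (force simp: Nodes_def image_iff)
  then have "finite Nodes" by (rule finite_subset) (use finQ fin in \<open>simp add: PN_def\<close>)
  moreover have "{n. \<exists>s. Inl (s, n) \<in> Q} \<subseteq> (\<lambda>q. case q of Inl (s, n) \<Rightarrow> n | Inr b \<Rightarrow> undefined) ` Q"
    by (force simp: image_iff)
  then have "finite {n. \<exists>s. Inl (s, n) \<in> Q}" by (rule finite_subset) (use finQ in simp)
  ultimately have "finite ((\<Union>A\<in>Nodes. insert (fst (snd A)) (set (snd (snd A)))) \<union> {n. \<exists>s. Inl (s, n) \<in> Q})"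
    by auto
  \<comment> \<open>\<open>B\<close> exceeds every number that occurs in a prescribed node, in a
    node with a frozen leaf bit, or as a statement with a frozen label; nodes that mention a number
    from \<open>B\<close> on as an argument of \<open>Bn\<close> forbids are therefore
    fresh.\<close>
  then obtain B where B: "\<forall>m\<in>(\<Union>A\<in>Nodes. insert (fst (snd A)) (set (snd (snd A)))) \<union> {n. \<exists>s. Inl (s, n) \<in> Q}. m < B"
    using finite_nat_set_iff_bounded by meson
  have Bn: "fst (snd A) < B" "j \<in> set (snd (snd A)) \<Longrightarrow> j < B" if "A \<in> Nodes" for A j
    using B that by blast+
  have Bl: "n < B" if "Inl (s, n) \<in> Q" for s n using B that by blast
  \<comment> \<open>The first component gives the child the rank \<open>rho A\<close>, the second
    makes its number at least \<open>B\<close>.\<close>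
  define en where "en A = prod_encode (rho A, B)" for A
  have child_rank_en: "child_rank (en A) = rho A" for A by (simp add: en_def child_rank_def)
  have en_B: "B \<le> en A" for A by (simp add: en_def le_prod_encode_2)
  \<comment> \<open>The fresh roots are the true statements required at the strings outside
    \<open>Z0\<close>; the fresh children cut truth off above \<open>rho A\<close>.\<close>
  define Fr where "Fr = {(s, B, []) |s. s \<notin> Z0} \<union> (\<lambda>A. child A (en A)) ` PN"
  have PNodes: "A \<in> Nodes" if "A \<in> PN" for A using that by (simp add: Nodes_def)
  have Fr_big: "fst (snd A) = B \<or> (\<exists>A'. en A' \<in> set (snd (snd A)))" if AF: "A \<in> Fr" for A
  proof -
    consider s where "A = (s, B, [])" | A' where "A = child A' (en A')" using AF unfolding Fr_def by blast
    then show ?thesis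
    proof cases
      case 2 then show ?thesis by (intro disjI2 exI[of _ A']) (simp add: child_def)
    qed simp
  qed
  have FrN: "A \<notin> Nodes" if "A \<in> Fr" for A
  proof
    assume N: "A \<in> Nodes"
    show False using Fr_big[OF that] Bn[OF N] en_B by (metis leD less_irrefl)
  qed
  have chFr: "child A j \<notin> PN \<union> Fr" if "A \<in> Fr" for A j
  proof
    assume ch: "child A j \<in> PN \<union> Fr"
    have "child A j \<notin> Nodes"
    proof
      assume N: "child A j \<in> Nodes"
      have "fst (snd (child A j)) = B \<or> (\<exists>A'. en A' \<in> set (snd (snd (child A j))))"
        using Fr_big[OF that] by (auto simp: child_def)
      then show False using Bn[OF N] en_B by (metis leD less_irrefl)
    qed
    then have "child A j \<notin> PN" using PNodes by blast
    then obtain A' where A': "A' \<in> PN" "child A j = child A' (en A')"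
      using ch by (auto simp: Fr_def child_def)
    then have "A = A'" by (simp add: child_def prod_eq_iff)
    then show False using A'(1) FrN[OF that] PNodes by blast
  qed
  define x' where "x' k = (if k < K then x k else
      (case (from_nat k :: (bool list \<times> nat) + (node \<times> nat)) of
         Inl (s, n) \<Rightarrow> L s | Inr (A, j) \<Rightarrow> A \<notin> PN \<union> Fr))" for k
  have leaf_at': "leaf_at x' A j = (if Inr (A, j) \<in> Q then leaf_at x A j else A \<notin> PN \<union> Fr)" for A j
    by (simp add: leaf_at_def x'_def Q_def)
  have label': "label x' s n = (if Inl (s, n) \<in> Q then label x s n else L s)" for s n
    by (simp add: label_def x'_def Q_def)
  \<comment> \<open>Only finitely many leaf bits of \<open>A\<close> are frozen, and the others are
    set.\<close>
  have nt: "\<not> true_at x' c A" if "A \<notin> PN \<union> Fr" for c A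
  proof -
    have "infinite (range (\<lambda>j. Inr (A, j) :: (bool list \<times> nat) + (node \<times> nat)))"
      by (rule range_inj_infinite) (simp add: inj_on_def)
    then have "\<not> range (\<lambda>j. Inr (A, j)) \<subseteq> Q" using finQ finite_subset by blast
    then obtain j where "Inr (A, j) \<notin> Q" by blast
    then have "leaf_at x' A j" using that by (simp add: leaf_at')
    then have "evidence x' c A j" by (simp add: evidence_def)
    then show ?thesis by (auto simp: true_at_iff_evidence)
  qed
  \<comment> \<open>A fresh node has no leaves, and by \<open>chFr\<close> all its children are
    false at every rank.\<close>
  have trFr: "true_at x' c A" if "A \<in> Fr" for c A
  proof -
    have "\<not> evidence x' c A j" for j
      using FrN[OF that] nt[OF chFr[OF that]] that by (auto simp: evidence_def leaf_at' Nodes_def)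
    then show ?thesis by (simp add: true_at_iff_evidence)
  qed
  have nPN: "\<not> true_at x' c A" if "A \<in> PN" "lt (rho A) c" for c A
  proof -
    have "evidence x' c A (en A)" using trFr[of "child A (en A)"] that child_rank_en by (auto simp: evidence_def Fr_def)
    then show ?thesis by (auto simp: true_at_iff_evidence)
  qed
  \<comment> \<open>No leafless child is evidence at a rank up to \<open>rho A\<close>: a prescribed
    one is false at its own rank by consistency, and the fresh one has rank \<open>rho A\<close>,
    which is not below \<open>c\<close>.\<close>
  have trPN: "true_at x' c A" if A: "A \<in> PN" and c: "\<not> lt (rho A) c" for c A
  proof -
    have "\<not> evidence x' c A j" for j
    proof
      assume "evidence x' c A j"
      moreover have "\<not> leaf_at x' A j" using leaf[OF rho(1)[OF A]] A by (simp add: leaf_at')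
      ultimately have j: "lt (child_rank j) c" "true_at x' (child_rank j) (child A j)" by (auto simp: evidence_def)
      then consider "child A j \<in> PN" | "child A j \<in> Fr" using nt by blast
      then show False
      proof cases
        case 1
        have "lt (child_rank j) (rho A)" using j(1) c lt_total lt_trans by blast
        then have "lt (rho (child A j)) (child_rank j)" using consistent rho(1) A 1 by blast
        then show False using nPN 1 j(2) by blast
      next
        case 2
        then obtain A' where A': "A' \<in> PN" "child A j = child A' (en A')" by (auto simp: Fr_def child_def)
        then have "A = A'" "j = en A'" by (simp_all add: child_def prod_eq_iff)
        then show False using j(1) c child_rank_en by simp
      qed
    qed
    then show ?thesis by (simp add: true_at_iff_evidence)
  qed
  show thesis
  proof
    show "x' k = x k" if "k < K" for k using that by (simp add: x'_def)
    show "true_at x' c A" if "(c, A) \<in> P" for c A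
    proof (rule trPN)
      show "A \<in> PN" using that by (force simp: PN_def)
      show "\<not> lt (rho A) c" using rho(2)[OF that] .
    qed
    show "\<exists>n. T x' s n" if "s \<notin> Z0" for s using trFr[of "(s, B, [])" a] that by (auto simp: Fr_def)
    show "s \<notin> Z0 \<and> label x' s n = L s" if t: "T x' s n" for s n
    proof -
      consider "(s, n, []) \<in> PN" | "(s, n, []) \<in> Fr" using nt t by blast
      then show ?thesis
      proof cases
        case 1
        then have "\<not> lt (rho (s, n, [])) a" using nPN t by blast
        then show ?thesis using root[OF rho(1)[OF 1]] by (auto simp: label')
      next
        case 2
        then have "n = B" "s \<notin> Z0" by (auto simp: Fr_def child_def)
        then show ?thesis using Bl[of s n] by (auto simp: label')
      qed
    qed
  qed
qed

end

lemma eventually_sequentially_ex: "eventually P sequentially \<Longrightarrow> \<exists>N. P N"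
  by (auto simp: eventually_sequentially)

section \<open>Embedding into the product space\<close>

lemma openin_discrete_product:
  fixes S :: "(nat \<Rightarrow> 'b) set"
  shows "openin (product_topology (\<lambda>_. discrete_topology UNIV) UNIV) S
    \<longleftrightarrow> (\<forall>x\<in>S. \<exists>N. \<forall>y. (\<forall>k<N. y k = x k) \<longrightarrow> y \<in> S)"
proof
  assume S: "openin (product_topology (\<lambda>_. discrete_topology UNIV) UNIV) S"
  show "\<forall>x\<in>S. \<exists>N. \<forall>y. (\<forall>k<N. y k = x k) \<longrightarrow> y \<in> S"
  proof
    fix x assume "x \<in> S"
    then obtain U where U: "finite {i. U i \<noteq> UNIV}" "x \<in> Pi\<^sub>E UNIV U" "Pi\<^sub>E UNIV U \<subseteq> S"
      using S by (auto simp: openin_product_topology_alt)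
    then obtain N where N: "\<forall>i\<in>{i. U i \<noteq> UNIV}. i < N" using finite_nat_set_iff_bounded by blast
    have "y \<in> S" if "\<forall>k<N. y k = x k" for y
    proof -
      have "y i \<in> U i" for i using N U(2) that by (cases "U i = UNIV") (auto simp: PiE_iff)
      then show ?thesis using U(3) by (auto simp: PiE_iff)
    qed
    then show "\<exists>N. \<forall>y. (\<forall>k<N. y k = x k) \<longrightarrow> y \<in> S" by blast
  qed
next
  assume S: "\<forall>x\<in>S. \<exists>N. \<forall>y. (\<forall>k<N. y k = x k) \<longrightarrow> y \<in> S"
  show "openin (product_topology (\<lambda>_. discrete_topology UNIV) UNIV) S"
    unfolding openin_product_topology_alt
  proof
    fix x assume "x \<in> S"
    then obtain N where N: "\<forall>y. (\<forall>k<N. y k = x k) \<longrightarrow> y \<in> S" using S by blast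
    define U where "U k = (if k < N then {x k} else UNIV)" for k
    have "{i. U i \<noteq> UNIV} \<subseteq> {..<N}" by (auto simp: U_def)
    then have "finite {i. U i \<noteq> UNIV}" by (rule finite_subset) simp
    moreover have "y k = x k" if "y \<in> Pi\<^sub>E UNIV U" "k < N" for y k
      using PiE_mem[OF that(1), of k] that(2) by (simp add: U_def)
    then have "Pi\<^sub>E UNIV U \<subseteq> S" using N by blast
    moreover have "x \<in> Pi\<^sub>E UNIV U" by (auto simp: PiE_iff U_def)
    ultimately show "\<exists>U. finite {i \<in> UNIV. U i \<noteq> topspace (discrete_topology UNIV)} \<and>
             (\<forall>i\<in>UNIV. openin (discrete_topology UNIV) (U i)) \<and> x \<in> Pi\<^sub>E UNIV U \<and> Pi\<^sub>E UNIV U \<subseteq> S"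
      by (intro exI[of _ U]) auto
  qed
qed

lemma openin_CB_top:
  "openin CB_top S \<longleftrightarrow>
    (\<forall>p\<in>S. \<exists>N. \<forall>q. (\<forall>k<N. fst q k = fst p k \<and> snd q k = snd p k) \<longrightarrow> q \<in> S)"
proof
  assume "openin CB_top S"
  then have S: "\<exists>U V. openin cantor_top U \<and> openin baire_top V \<and> x \<in> U \<and> y \<in> V \<and> U \<times> V \<subseteq> S"
    if "(x, y) \<in> S" for x y
    using that unfolding CB_top_def openin_prod_topology_alt by blast
  show "\<forall>p\<in>S. \<exists>N. \<forall>q. (\<forall>k<N. fst q k = fst p k \<and> snd q k = snd p k) \<longrightarrow> q \<in> S"
  proof
    fix p assume p: "p \<in> S"
    obtain U V where U: "openin cantor_top U" "openin baire_top V" "fst p \<in> U" "snd p \<in> V" "U \<times> V \<subseteq> S"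
      using S[of "fst p" "snd p"] p by auto
    obtain N where N: "\<forall>y. (\<forall>k<N. y k = fst p k) \<longrightarrow> y \<in> U"
      using U(1,3) unfolding cantor_top_def openin_discrete_product by blast
    obtain K where K: "\<forall>y. (\<forall>k<K. y k = snd p k) \<longrightarrow> y \<in> V"
      using U(2,4) unfolding baire_top_def openin_discrete_product by blast
    have "q \<in> S" if q: "\<forall>k<max N K. fst q k = fst p k \<and> snd q k = snd p k" for q
    proof -
      have "fst q \<in> U" "snd q \<in> V" using N K q by auto
      then show ?thesis using U(5) by (metis mem_Times_iff subsetD)
    qed
    then show "\<exists>N. \<forall>q. (\<forall>k<N. fst q k = fst p k \<and> snd q k = snd p k) \<longrightarrow> q \<in> S" by blast
  qed
next
  assume S: "\<forall>p\<in>S. \<exists>N. \<forall>q. (\<forall>k<N. fst q k = fst p k \<and> snd q k = snd p k) \<longrightarrow> q \<in> S"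
  show "openin CB_top S"
    unfolding CB_top_def openin_prod_topology_alt
  proof (intro allI impI)
    fix x y assume "(x, y) \<in> S"
    then obtain N where N: "\<forall>q. (\<forall>k<N. fst q k = x k \<and> snd q k = y k) \<longrightarrow> q \<in> S"
      using bspec[OF S, of "(x, y)"] by auto
    define U where "U = {x'. \<forall>k<N. x' k = x k}"
    define V where "V = {y'. \<forall>k<N. y' k = y k}"
    have "openin cantor_top U" unfolding cantor_top_def openin_discrete_product
      by (intro ballI exI[of _ N]) (auto simp: U_def)
    moreover have "openin baire_top V" unfolding baire_top_def openin_discrete_product
      by (intro ballI exI[of _ N]) (auto simp: V_def)
    moreover have "x \<in> U" "y \<in> V" "U \<times> V \<subseteq> S" using N by (auto simp: U_def V_def)
    ultimately show "\<exists>U V. openin cantor_top U \<and> openin baire_top V \<and> x \<in> U \<and> y \<in> V \<and> U \<times> V \<subseteq> S"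
      by blast
  qed
qed

lemma topspace_CB_top [simp]: "topspace CB_top = UNIV"
  by (simp add: CB_top_def cantor_top_def baire_top_def)

section \<open>The embedding and the spaces on which category is used\<close>

context ranks
begin

abbreviation R :: "(nat \<times> nat) set" where
  "R \<equiv> {(c, d). c = d \<or> lt c d}"

text \<open>The leading 0 is a tag that keeps these points apart from the fillers added later, which
  get 1 and 2. The observations include the bits of the branch, which makes \<open>embed\<close>
  injective.\<close>

definition embed :: "point \<Rightarrow> (nat \<Rightarrow> bool) \<times> (nat \<Rightarrow> nat)" where
  "embed z = (snd z, case_nat 0 (obs_seq {} {} z))"

lemma down_closed_empty: "down_closed {}" and down_closed_UNIV: "down_closed UNIV" and down_closed_lt: "down_closed {c. lt c a}"
  by (auto simp: down_closed_def intro: lt_trans)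

lemma embed_continuous:
  assumes "openin CB_top A" "embed u \<in> A" "u \<in> F"
  shows "\<forall>\<^sub>F N in sequentially. \<forall>v\<in>nbhd {} (\<lambda>c. c) u N. embed v \<in> A"
proof -
  obtain K where K: "\<forall>q. (\<forall>k<K. fst q k = fst (embed u) k \<and> snd q k = snd (embed u) k) \<longrightarrow> q \<in> A"
    using assms(1,2) unfolding openin_CB_top by blast
  have "\<forall>\<^sub>F N in sequentially. \<forall>v\<in>nbhd {} (\<lambda>c. c) u N. \<forall>p<K. obs_seq {} {} v p = obs_seq {} {} u p"
    by (rule nbhd_obs_seq) (use assms(3) down_closed_empty in auto)
  then show ?thesis using eventually_ge_at_top[of K]
  proof eventually_elim
    case (elim N)
    show ?case
    proof
      fix v assume v: "v \<in> nbhd {} (\<lambda>c. c) u N"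
      have "fst (embed v) k = fst (embed u) k" if "k < K" for k using nbD(2)[OF v] that elim(2) by (simp add: embed_def)
      moreover have "snd (embed v) k = snd (embed u) k" if "k < K" for k
        using bspec[OF elim(1) v] that by (cases k) (auto simp: embed_def)
      ultimately show "embed v \<in> A" using K by blast
    qed
  qed
qed

text \<open>
  \<open>None\<close> stands for \<open>F\<close> with the topology deciding all facts of rank below \<open>a\<close>, and \<open>Some s\<close> for
  the points whose branches part at \<open>s\<close>, with the topology deciding all facts.
\<close>

fun space_of :: "bool list option \<Rightarrow> point set" where
  "space_of None = F" | "space_of (Some s) = G s"
fun known_ranks :: "bool list option \<Rightarrow> nat set" where
  "known_ranks None = {c. lt c a}" | "known_ranks (Some s) = UNIV"
fun rooted :: "bool list option \<Rightarrow> bool list set" where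
  "rooted None = {}" | "rooted (Some s) = - {s}"
fun rootless :: "bool list option \<Rightarrow> bool list set" where
  "rootless None = {}" | "rootless (Some s) = {s}"
text \<open>From this level on a neighbourhood fixes the branch along \<open>s\<close>, so that it
  still passes through \<open>s\<close>.\<close>

fun min_level :: "bool list option \<Rightarrow> nat" where
  "min_level None = 0" | "min_level (Some s) = length s"

lemma code_space_space_of: "code_space (space_of q) (obs_seq (known_ranks q) (rooted q))"
  by (cases q) (auto intro: code_space_F code_space_G down_closed_lt)

lemma space_of_F: "z \<in> space_of q \<Longrightarrow> z \<in> F"
  by (cases q) (auto simp: G_def)

lemma down_closed_known_ranks: "down_closed (known_ranks q)"
  using down_closed_lt down_closed_UNIV by (cases q) auto

lemma space_of_rooted: "z \<in> space_of q \<Longrightarrow> s \<in> rooted q \<Longrightarrow> \<exists>n. T (snd z) s n"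
  by (cases q) (auto simp: G_def)

lemma rooted_known_ranks: "rooted q = {} \<or> known_ranks q = UNIV"
  by (cases q) auto

lemma nbhd_cyl:
  assumes "u \<in> space_of q"
  shows "\<forall>\<^sub>F N in sequentially. nbhd (known_ranks q) (\<lambda>c. c) u N \<inter> space_of q \<subseteq> code_space.cyl (space_of q) (obs_seq (known_ranks q) (rooted q)) u K"
proof -
  have "\<forall>\<^sub>F N in sequentially. \<forall>v\<in>nbhd (known_ranks q) (\<lambda>c. c) u N. \<forall>p<K. obs_seq (known_ranks q) (rooted q) v p = obs_seq (known_ranks q) (rooted q) u p"
    by (rule nbhd_obs_seq[OF down_closed_known_ranks rooted_known_ranks space_of_F[OF assms] space_of_rooted[OF assms]])
  then show ?thesis
    by (rule eventually_mono) (auto simp: code_space.cyl_def[OF code_space_space_of])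
qed

lemma cyl_nbhd:
  assumes "v \<in> nbhd D t u N" "\<And>c. c \<in> D \<Longrightarrow> t c \<in> known_ranks q"
  shows "\<forall>\<^sub>F K in sequentially. code_space.cyl (space_of q) (obs_seq (known_ranks q) (rooted q)) v K \<subseteq> nbhd D t u N"
proof -
  have "\<forall>\<^sub>F K in sequentially. \<forall>w. (\<forall>p<K. obs_seq (known_ranks q) (rooted q) w p = obs_seq (known_ranks q) (rooted q) v p) \<longrightarrow> w \<in> nbhd D t u N"
    by (rule nbhd_open[OF assms])
  then show ?thesis
    by (rule eventually_mono) (auto simp: code_space.cyl_def[OF code_space_space_of])
qed

lemma is_open_nbhd:
  assumes "\<And>c. c \<in> D \<Longrightarrow> t c \<in> known_ranks q"
  shows "code_space.is_open (space_of q) (obs_seq (known_ranks q) (rooted q)) (nbhd D t u N)"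
  unfolding code_space.is_open_def[OF code_space_space_of]
proof
  fix v assume "v \<in> nbhd D t u N \<inter> space_of q"
  then have "v \<in> nbhd D t u N" by blast
  from eventually_sequentially_ex[OF cyl_nbhd[OF this assms]]
  show "\<exists>K. code_space.cyl (space_of q) (obs_seq (known_ranks q) (rooted q)) v K \<subseteq> nbhd D t u N" .
qed

lemma nbhd_self: "u \<in> nbhd D (\<lambda>c. c) u N"
  by (simp add: nbhd_def)

lemma is_open_embed:
  assumes "openin CB_top A"
  shows "code_space.is_open (space_of q) (obs_seq (known_ranks q) (rooted q)) {z. embed z \<in> A}"
  unfolding code_space.is_open_def[OF code_space_space_of]
proof
  fix u assume u: "u \<in> {z. embed z \<in> A} \<inter> space_of q"
  then obtain N where N: "\<forall>v\<in>nbhd {} (\<lambda>c. c) u N. embed v \<in> A"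
    using eventually_sequentially_ex[OF embed_continuous[OF assms]] space_of_F by blast
  obtain K where "code_space.cyl (space_of q) (obs_seq (known_ranks q) (rooted q)) u K \<subseteq> nbhd {} (\<lambda>c. c) u N"
    using eventually_sequentially_ex[OF cyl_nbhd[OF nbhd_self, of "{}" q u N]] by blast
  then show "\<exists>K. code_space.cyl (space_of q) (obs_seq (known_ranks q) (rooted q)) u K \<subseteq> {z. embed z \<in> A}" using N by blast
qed

lemma decided_embed:
  assumes "Sigma_class CB_top R b A"
  shows "code_space.decided (space_of q) (obs_seq (known_ranks q) (rooted q)) {z. embed z \<in> A}"
proof -
  interpret code_space "space_of q" "obs_seq (known_ranks q) (rooted q)" by (rule code_space_space_of)
  show ?thesis using assms
  proof induction
    case (open_class S b)
    then show ?case by (intro decided_is_open is_open_embed)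
  next
    case (union_class b A)
    have "decided {z. embed z \<in> A n}" for n
    proof -
      have "decided {z. embed z \<in> topspace CB_top - A n}" using union_class by blast
      from decided_Compl[OF this] show ?thesis by (rule decided_cong) auto
    qed
    then have "decided (\<Union>n. {z. embed z \<in> A n})" by (rule decided_UN)
    then show ?case by (rule decided_cong) auto
  qed
qed

lemma realize_facts:
  assumes v: "v \<in> F" and rootless: "\<And>s. s \<in> rootless q \<Longrightarrow> on_branch (fst v) s" and fin: "finite P"
    and leaf: "\<And>c A j. (c, A) \<in> P \<Longrightarrow> \<not> leaf_at (snd v) A j"
    and consistent: "\<And>c A d j. (c, A) \<in> P \<Longrightarrow> (d, child A j) \<in> P \<Longrightarrow> lt (child_rank j) c \<Longrightarrow> lt d (child_rank j)"
    and root: "\<And>c s n. (c, (s, n, [])) \<in> P \<Longrightarrow> \<not> lt c a \<Longrightarrow>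
        s \<notin> rootless q \<and> (if on_branch (fst v) s then \<not> visible v (s, n, []) else T (snd v) s n)"
  shows "\<exists>w\<in>space_of q. fst w = fst v \<and> (\<forall>k<K. snd w k = snd v k) \<and> (\<forall>(c, A)\<in>P. true_at (snd w) c A)"
proof -
  \<comment> \<open>On the branch of \<open>v\<close> a true statement must carry the next bit.
    Elsewhere \<open>L\<close> is the label shared by the true statements of \<open>v\<close>, so
    that prescribed statements of full rank keep their labels.\<close>
  define L where "L s = (if on_branch (fst v) s then fst v (length s) else label (snd v) s (SOME n. T (snd v) s n))" for s
  have L: "s \<notin> rootless q \<and> label (snd v) s n = L s" if "(c, (s, n, [])) \<in> P" "\<not> lt c a" for c s n
  proof (cases "on_branch (fst v) s")
    case True then show ?thesis using root[OF that] by (auto simp: L_def visible_def)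
  next
    case False
    then have "T (snd v) s n" "s \<notin> rootless q" using root[OF that] by auto
    moreover have "T (snd v) s (SOME n. T (snd v) s n)" using calculation(1) by (rule someI)
    ultimately have "label (snd v) s n = label (snd v) s (SOME n. T (snd v) s n)"
      using v False unfolding F_def by blast
    then show ?thesis using \<open>s \<notin> rootless q\<close> False by (simp add: L_def)
  qed
  show ?thesis
  proof (rule extension[of P "snd v" "rootless q" L K])
    show "finite P" by (rule fin)
    show "\<not> leaf_at (snd v) A j" if "(c, A) \<in> P" for c A j using leaf[OF that] .
    show "lt d (child_rank j)" if "(c, A) \<in> P" "(d, child A j) \<in> P" "lt (child_rank j) c" for c A d j using consistent[OF that] .
    show "s \<notin> rootless q \<and> label (snd v) s n = L s" if "(c, (s, n, [])) \<in> P" "\<not> lt c a" for c s n using L[OF that] .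
  next
    fix x' assume x': "\<And>k. k < K \<Longrightarrow> x' k = snd v k" "\<And>c A. (c, A) \<in> P \<Longrightarrow> true_at x' c A"
      "\<And>s n. T x' s n \<Longrightarrow> s \<notin> rootless q \<and> label x' s n = L s" "\<And>s. s \<notin> rootless q \<Longrightarrow> \<exists>n. T x' s n"
    have "label x' s n = fst v (length s)" if "on_branch (fst v) s" "T x' s n" for s n
      using x'(3)[OF that(2)] that(1) by (simp add: L_def)
    moreover have "label x' s n = label x' s m" if "T x' s n" "T x' s m" for s n m
      using x'(3)[OF that(1)] x'(3)[OF that(2)] by simp
    moreover have "\<exists>n. T x' s n" if "\<not> on_branch (fst v) s" for s using x'(4) rootless that by blast
    ultimately have "(fst v, x') \<in> F" unfolding F_def mem_Collect_eq fst_conv snd_conv by blast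
    then have "(fst v, x') \<in> space_of q" using x'(3,4) rootless by (cases q) (auto simp: G_def)
    then show ?thesis using x'(1,2) by (intro bexI[of _ "(fst v, x')"]) auto
  qed
qed

lemma finite_codes: "finite {q :: nat \<times> node. to_nat q < N}"
proof -
  have "finite (to_nat -` {..<N} :: (nat \<times> node) set)" by (rule finite_vimageI) auto
  then show ?thesis by (simp add: vimage_def)
qed

text \<open>Once the branch is fixed, the visibility of a node depends on a single bit of
  \<open>x\<close>, the label of its root.\<close>

lemma visible_agree:
  "\<forall>\<^sub>F K in sequentially. \<forall>v w. fst w = fst v \<and> (\<forall>k<K. snd w k = snd v k) \<longrightarrow>
     (\<forall>c A. to_nat (c :: nat, A) < N \<longrightarrow> visible w A = visible v A)"
proof -
  define co :: "nat \<times> node \<Rightarrow> nat" where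
    "co q = to_nat (Inl (fst (snd q), fst (snd (snd q))) :: (bool list \<times> nat) + (node \<times> nat))" for q
  have "finite (co ` {q. to_nat q < N})" by (rule finite_imageI[OF finite_codes])
  then obtain K0 where K0: "\<forall>k\<in>co ` {q. to_nat q < N}. k < K0"
    using finite_nat_set_iff_bounded by meson
  have co: "to_nat (Inl (fst A, fst (snd A)) :: (bool list \<times> nat) + (node \<times> nat)) < K0"
    if "to_nat (c :: nat, A) < N" for c and A :: node
  proof -
    have "co (c, A) \<in> co ` {q. to_nat q < N}" using that by blast
    then have "co (c, A) < K0" using K0 by blast
    then show ?thesis by (simp add: co_def)
  qed
  have "visible w A = visible v A" if "fst w = fst v" "\<forall>k<K. snd w k = snd v k" "to_nat (c :: nat, A) < N" "K0 \<le> K"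
    for v w c A K
    using that co[OF that(3)] by (auto simp: visible_def label_def)
  then show ?thesis using eventually_ge_at_top[of K0] by (elim eventually_mono) blast
qed

section \<open>Lowered ranks and density\<close>

definition min_rank :: "nat \<Rightarrow> nat \<Rightarrow> nat" where
  "min_rank c b = (if lt c b then c else b)"

lemma true_at_min_rank: "true_at x c A \<Longrightarrow> true_at x (min_rank c b) A"
  using true_at_mono[of x c A b] by (auto simp: min_rank_def)

lemma lt_min_rank: "lt d (min_rank c b) \<longleftrightarrow> lt d c \<and> lt d b"
proof (cases "lt c b")
  case True then show ?thesis using lt_trans[of d c b] by (auto simp: min_rank_def)
next
  case False then show ?thesis using lt_total[of c b] lt_trans[of d b c] by (auto simp: min_rank_def)
qed

lemma true_at_no_leaf: "true_at x c A \<Longrightarrow> \<not> leaf_at x A j"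
  by (subst (asm) true_at.simps) blast

lemma true_at_child: "true_at x c A \<Longrightarrow> true_at x d (child A j) \<Longrightarrow> lt (child_rank j) c \<Longrightarrow> lt d (child_rank j)"
proof (rule ccontr)
  assume t: "true_at x c A" "true_at x d (child A j)" "lt (child_rank j) c" "\<not> lt d (child_rank j)"
  then have "true_at x (child_rank j) (child A j)" using true_at_mono by blast
  then show False using t(1,3) by (subst (asm) true_at.simps) blast
qed

text \<open>The finite combinatorics of retagging: \<open>v\<close> satisfies the invisible facts of
  \<open>u\<close> only up to rank \<open>b\<close>, while \<open>w\<close> gets them back in full
  and keeps the facts \<open>P\<close> of \<open>v\<close>. The two sets cannot clash, since the
  invisible part of \<open>P\<close> lies below \<open>b\<close>, where a fact of \<open>u\<close>
  and its lowered version impose the same conditions.\<close>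

lemma dense_extension:
  assumes u: "u \<in> space_of q" "min_level q \<le> N" and v: "v \<in> F" "v \<in> nbhd (known_ranks q) (\<lambda>c. min_rank c b) u N" and b: "lt b a"
    and P: "finite P" "\<And>c A. (c, A) \<in> P \<Longrightarrow> true_at (snd v) c A \<and> (visible v A \<or> lt c b)"
  shows "\<exists>w\<in>space_of q. w \<in> nbhd (known_ranks q) (\<lambda>c. c) u N \<and> fst w = fst v \<and> (\<forall>k<K. snd w k = snd v k)
     \<and> (\<forall>(c, A)\<in>P. true_at (snd w) c A) \<and> (\<forall>c A. to_nat (c :: nat, A) < K \<longrightarrow> visible w A = visible v A)"
proof -
  define Pu where "Pu = {(c, A). to_nat (c, A) < N \<and> true_at (snd u) c A \<and> (visible u A \<or> c \<in> known_ranks q)}"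
  have "finite Pu" by (rule finite_subset[OF _ finite_codes[of N]]) (auto simp: Pu_def)
  have Pu: "true_at (snd u) c A" "visible u A = visible v A" "true_at (snd v) (if visible v A then c else min_rank c b) A"
    if "(c, A) \<in> Pu" for c A
    using that nbD(3,4,5)[OF v(2), of c A] by (auto simp: Pu_def)
  obtain K' where K': "K' \<ge> K" "K' \<ge> N" "\<And>v w c A. \<lbrakk>fst w = fst v; \<forall>k<K'. snd w k = snd v k;
      to_nat (c :: nat, A) < max N K\<rbrakk> \<Longrightarrow> visible w A = visible v A"
  proof -
    have "\<forall>\<^sub>F K' in sequentially. K' \<ge> K \<and> K' \<ge> N \<and> (\<forall>v w. fst w = fst v \<and> (\<forall>k<K'. snd w k = snd v k) \<longrightarrow>
     (\<forall>c A. to_nat (c :: nat, A) < max N K \<longrightarrow> visible w A = visible v A))"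
      using visible_agree[of "max N K"] eventually_ge_at_top[of K] eventually_ge_at_top[of N]
      by eventually_elim blast
    then obtain K' where "K' \<ge> K \<and> K' \<ge> N \<and> (\<forall>v w. fst w = fst v \<and> (\<forall>k<K'. snd w k = snd v k) \<longrightarrow>
     (\<forall>c A. to_nat (c :: nat, A) < max N K \<longrightarrow> visible w A = visible v A))"
      using eventually_sequentially_ex by blast
    then show thesis using that by blast
  qed
  have "\<exists>w\<in>space_of q. fst w = fst v \<and> (\<forall>k<K'. snd w k = snd v k) \<and> (\<forall>(c, A)\<in>P \<union> Pu. true_at (snd w) c A)"
  proof (rule realize_facts[OF v(1)])
    show "on_branch (fst v) s" if "s \<in> rootless q" for s
    proof -
      have "on_branch (fst u) s" "length s \<le> N" using that u by (cases q; auto simp: G_def)+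
      then show ?thesis using nbD(1)[OF v(2)] by (auto simp: on_branch_def)
    qed
    show "finite (P \<union> Pu)" using P(1) \<open>finite Pu\<close> by simp
    show "\<not> leaf_at (snd v) A j" if "(c, A) \<in> P \<union> Pu" for c A j
      using that P(2)[of c A] Pu(3)[of c A] true_at_no_leaf by blast
    show "lt d (child_rank j)" if 1: "(c, A) \<in> P \<union> Pu" and 2: "(d, child A j) \<in> P \<union> Pu" and j: "lt (child_rank j) c" for c A d j
    proof (cases "visible v A")
      case True
      then have "true_at (snd v) c A" "true_at (snd v) d (child A j)"
        using 1 2 P(2)[of c A] Pu(3)[of c A] P(2)[of d "child A j"] Pu(3)[of d "child A j"] by auto
      then show ?thesis using true_at_child j by blast
    next
      case False
      consider "(c, A) \<in> P" "(d, child A j) \<in> P" | "(c, A) \<in> P" "(d, child A j) \<in> Pu"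
        | "(c, A) \<in> Pu" "(d, child A j) \<in> P" | "(c, A) \<in> Pu" "(d, child A j) \<in> Pu" using 1 2 by blast
      then show ?thesis
      proof cases
        case 1 then show ?thesis using P(2) true_at_child j by blast
      next
        case 2
        have "lt c b" using P(2)[OF 2(1)] False by blast
        then have "lt (child_rank j) b" using j lt_trans by blast
        \<comment> \<open>As \<open>child_rank j\<close> is below \<open>b\<close>, so is
          \<open>min_rank d b\<close>, which must therefore be \<open>d\<close> itself.\<close>
        moreover have "lt (min_rank d b) (child_rank j)"
          using Pu(3)[OF 2(2)] False P(2)[OF 2(1)] true_at_child[of "snd v" c A "min_rank d b" j] j by simp
        ultimately show ?thesis using lt_asym by (auto simp: min_rank_def split: if_splits)
      next
        case 3
        have d: "lt d b" "true_at (snd v) d (child A j)" using P(2)[OF 3(2)] False by auto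
        have t: "true_at (snd v) (min_rank c b) A" using Pu(3)[OF 3(1)] False by simp
        show ?thesis
        \<comment> \<open>Below \<open>b\<close> the lowered fact about \<open>A\<close> already
          constrains this child; from \<open>b\<close> on, \<open>lt d b\<close> is enough.\<close>
        proof (cases "lt (child_rank j) b")
          case True
          then show ?thesis using true_at_child[OF t d(2)] j by (simp add: lt_min_rank)
        next
          case nbhd: False
          then show ?thesis using d(1) lt_total lt_trans by blast
        qed
      next
        case 4 then show ?thesis using Pu(1) true_at_child j by blast
      qed
    qed
    show "s \<notin> rootless q \<and> (if on_branch (fst v) s then \<not> visible v (s, n, []) else T (snd v) s n)"
      if r: "(c, (s, n, [])) \<in> P \<union> Pu" and c: "\<not> lt c a" for c s n
    proof (cases "visible v (s, n, [])")
      case True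
      then have "true_at (snd v) c (s, n, [])" using r P(2)[of c "(s, n, [])"] Pu(3)[of c "(s, n, [])"] by auto
      then have t: "T (snd v) s n" using c true_at_mono by blast
      have off: "\<not> on_branch (fst v) s" using t True v(1) by (auto simp: F_def visible_def)
      have "s \<notin> rootless q" using off \<open>\<And>s. s \<in> rootless q \<Longrightarrow> on_branch (fst v) s\<close> by blast
      then show ?thesis using off t by simp
    next
      case False
      then have on_branch: "on_branch (fst v) s" by (simp add: visible_def)
      \<comment> \<open>An invisible fact of full rank can only come from \<open>u\<close>, because
        those in \<open>P\<close> have rank below \<open>b\<close>, hence below
        \<open>a\<close>.\<close>
      have "(c, (s, n, [])) \<notin> P" using P(2)[of c "(s, n, [])"] False c b lt_trans by blast
      then have "true_at (snd u) c (s, n, [])" using r Pu(1) by blast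
      then have "T (snd u) s n" using c true_at_mono by blast
      then have "s \<notin> rootless q" using u(1) by (cases q) (auto simp: G_def)
      then show ?thesis using on_branch False by simp
    qed
  qed
  then obtain w where w: "w \<in> space_of q" "fst w = fst v" "\<forall>k<K'. snd w k = snd v k" "\<forall>(c, A)\<in>P \<union> Pu. true_at (snd w) c A"
    by blast
  have visible: "visible w A = visible v A" if "to_nat (c :: nat, A) < max N K" for c and A :: node using K'(3)[OF w(2,3) that] .
  have "w \<in> nbhd (known_ranks q) (\<lambda>c. c) u N"
    unfolding nbhd_def mem_Collect_eq
  proof (intro conjI allI impI)
    show "fst w k = fst u k" "snd w k = snd u k" if "k < N" for k
      using nbD(1,2)[OF v(2) that] w(2,3) that K'(2) by auto
    show "visible w A = visible u A" if "to_nat (c, A) < N" for c :: nat and A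
      using visible[of c A] nbD(3)[OF v(2) that] that by simp
    show "true_at (snd w) c A" if "to_nat (c, A) < N" "true_at (snd u) c A" "visible u A" for c A
      using w(4) that by (auto simp: Pu_def)
    show "true_at (snd w) c A" if "to_nat (c, A) < N" "true_at (snd u) c A" "c \<in> known_ranks q" for c A
      using w(4) that by (auto simp: Pu_def)
  qed
  moreover have "visible w A = visible v A" if "to_nat (c :: nat, A) < K" for c and A :: node using visible[of c A] that by simp
  ultimately show ?thesis using w K'(1) by (intro bexI[of _ w]) auto
qed

end

context ranks
begin

abbreviation meager_in :: "bool list option \<Rightarrow> point set \<Rightarrow> bool" where
  "meager_in q \<equiv> code_space.meager (space_of q) (obs_seq (known_ranks q) (rooted q))"

lemma min_rank_known_ranks: "lt b a \<Longrightarrow> min_rank c b \<in> known_ranks q"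
  by (cases q) (auto simp: min_rank_def intro: lt_trans)

section \<open>Transfer of meagerness\<close>

text \<open>
  A set of class \<open>b\<close> cannot distinguish invisible facts of rank \<open>b\<close> from those of higher rank, so
  its meagerness near \<open>u\<close> survives the passage to another space with ranks lowered to \<open>b\<close>.
\<close>

lemma transfer:
  assumes "Sigma_class CB_top R b A"
  shows "lt b a \<Longrightarrow> u \<in> space_of q \<Longrightarrow> min_level q \<le> N \<Longrightarrow> meager_in q {v \<in> nbhd (known_ranks q) (\<lambda>c. c) u N. embed v \<in> A}
    \<Longrightarrow> meager_in q' {v \<in> nbhd (known_ranks q) (\<lambda>c. min_rank c b) u N. embed v \<in> A}"
  using assms
proof (induction arbitrary: u N q q')
  case (open_class S b)
  interpret M: code_space "space_of q" "obs_seq (known_ranks q) (rooted q)" by (rule code_space_space_of)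
  interpret M': code_space "space_of q'" "obs_seq (known_ranks q') (rooted q')" by (rule code_space_space_of)
  \<comment> \<open>By density, a point \<open>v\<close> in \<open>S\<close> would yield a point
    \<open>w\<close> of the neighbourhood in \<open>space_of q\<close> that is still in
    \<open>S\<close>; but a nonempty open set is not meager.\<close>
  have False if v: "v \<in> space_of q'" "v \<in> nbhd (known_ranks q) (\<lambda>c. min_rank c b) u N" "embed v \<in> S" for v
  proof -
    obtain K where K: "\<forall>w\<in>nbhd {} (\<lambda>c. c) v K. embed w \<in> S"
      using eventually_sequentially_ex[OF embed_continuous[OF open_class(1) v(3) space_of_F[OF v(1)]]] by blast
    define P where "P = {(c, A). to_nat (c, A) < K \<and> true_at (snd v) c A \<and> visible v A}"
    have "finite P" by (rule finite_subset[OF _ finite_codes[of K]]) (auto simp: P_def)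
    moreover have "true_at (snd v) c A \<and> (visible v A \<or> lt c b)" if "(c, A) \<in> P" for c A
      using that by (simp add: P_def)
    ultimately obtain w where w: "w \<in> space_of q" "w \<in> nbhd (known_ranks q) (\<lambda>c. c) u N" "fst w = fst v"
      "\<forall>k<K. snd w k = snd v k" "\<forall>(c, A)\<in>P. true_at (snd w) c A"
      "\<forall>c A. to_nat (c :: nat, A) < K \<longrightarrow> visible w A = visible v A"
      using dense_extension[OF open_class(3,4) space_of_F[OF v(1)] v(2) open_class(2), of P K] by blast
    have "w \<in> nbhd {} (\<lambda>c. c) v K" using w(3-6) by (auto simp: nbhd_def P_def)
    then have "embed w \<in> S" using K by blast
    moreover have eq: "{v \<in> nbhd (known_ranks q) (\<lambda>c. c) u N. embed v \<in> S} = nbhd (known_ranks q) (\<lambda>c. c) u N \<inter> {z. embed z \<in> S}"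
      by blast
    have "M.is_open {v \<in> nbhd (known_ranks q) (\<lambda>c. c) u N. embed v \<in> S}"
      unfolding eq by (intro M.is_open_Int is_open_nbhd is_open_embed open_class)
    ultimately show False using M.is_open_not_meager[of _ w] open_class(5) w(1,2) by blast
  qed
  then have "{v \<in> nbhd (known_ranks q) (\<lambda>c. min_rank c b) u N. embed v \<in> S} \<inter> space_of q' \<subseteq> {}" by blast
  then show ?case by (rule M'.meager_subset[OF M'.meager_empty])
next
  case (union_class b A)
  interpret M: code_space "space_of q" "obs_seq (known_ranks q) (rooted q)" by (rule code_space_space_of)
  interpret M': code_space "space_of q'" "obs_seq (known_ranks q') (rooted q')" by (rule code_space_space_of)
  define W where "W = nbhd (known_ranks q) (\<lambda>c. min_rank c b) u N"
  have "M'.meager (W \<inter> {z. embed z \<in> A n})" for n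
  proof (rule ccontr)
    \<comment> \<open>Then the complement of \<open>A n\<close>, of lower class, is meager near some
      \<open>v\<close> in \<open>space_of q'\<close>. The induction hypothesis, with the two spaces
      exchanged, carries this back to \<open>space_of q\<close>, where \<open>V\<close> becomes a
      nonempty open set in which both \<open>A n\<close> and its complement are meager.\<close>
    assume nm: "\<not> ?thesis"
    obtain b' where b': "lt b' b" "Sigma_class CB_top R b' (UNIV - A n)"
      and IH: "\<And>u N q q'. lt b' a \<Longrightarrow> u \<in> space_of q \<Longrightarrow> min_level q \<le> N \<Longrightarrow>
        meager_in q {v \<in> nbhd (known_ranks q) (\<lambda>c. c) u N. embed v \<in> UNIV - A n}
        \<Longrightarrow> meager_in q' {v \<in> nbhd (known_ranks q) (\<lambda>c. min_rank c b') u N. embed v \<in> UNIV - A n}"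
      using union_class(1)[of n] by auto
    have b'a: "lt b' a" using b'(1) union_class(2) lt_trans by blast
    have "M'.decided {z. embed z \<in> A n}"
      by (rule M'.decided_cong[OF M'.decided_Compl[OF decided_embed[OF b'(2)]]]) auto
    moreover have "M'.is_open W" unfolding W_def by (rule is_open_nbhd) (rule min_rank_known_ranks[OF union_class(2)])
    ultimately obtain v K0 where v: "v \<in> W" "v \<in> space_of q'" "M'.meager (M'.cyl v K0 - {z. embed z \<in> A n})"
      using M'.comeager_cyl[of "{z. embed z \<in> A n}" W] nm by blast
    have "\<forall>\<^sub>F K in sequentially. min_level q' \<le> K \<and> nbhd (known_ranks q') (\<lambda>c. c) v K \<inter> space_of q' \<subseteq> M'.cyl v K0"
      using nbhd_cyl[OF v(2), of K0] eventually_ge_at_top[of "min_level q'"] by eventually_elim blast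
    then obtain K where K: "min_level q' \<le> K" "nbhd (known_ranks q') (\<lambda>c. c) v K \<inter> space_of q' \<subseteq> M'.cyl v K0"
      using eventually_sequentially_ex by blast
    have "M'.meager {w \<in> nbhd (known_ranks q') (\<lambda>c. c) v K. embed w \<in> UNIV - A n}"
      using v(3) by (rule M'.meager_subset) (use K(2) in blast)
    then have m: "M.meager {w \<in> nbhd (known_ranks q') (\<lambda>c. min_rank c b') v K. embed w \<in> UNIV - A n}"
      by (rule IH[OF b'a v(2) K(1)])
    define V where "V = nbhd (known_ranks q') (\<lambda>c. min_rank c b') v K \<inter> nbhd (known_ranks q) (\<lambda>c. c) u N"
    have "M.meager V"
      using M.meager_Un[OF m union_class(5)] by (rule M.meager_subset) (auto simp: V_def)
    moreover have "M.is_open V" unfolding V_def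
      by (intro M.is_open_Int is_open_nbhd) (auto intro: min_rank_known_ranks b'a)
    moreover have "\<exists>w\<in>space_of q. w \<in> V"
    proof -
      \<comment> \<open>Lowered to \<open>b'\<close>, all invisible facts about \<open>v\<close>
        have rank below \<open>b\<close>, as \<open>dense_extension\<close> demands; this uses that
        the class drops strictly.\<close>
      define P where "P = (\<lambda>(c, A). (if visible v A then c else min_rank c b', A)) ` {(c, A). to_nat (c, A) < K \<and> true_at (snd v) c A}"
      have "finite {(c, A). to_nat (c :: nat, A) < K \<and> true_at (snd v) c A}"
        by (rule finite_subset[OF _ finite_codes[of K]]) auto
      then have "finite P" by (simp add: P_def)
      moreover have "lt (min_rank c b') b" for c using b'(1) lt_trans by (auto simp: min_rank_def)
      then have "true_at (snd v) c A \<and> (visible v A \<or> lt c b)" if "(c, A) \<in> P" for c A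
        using that true_at_min_rank by (auto simp: P_def split: if_splits)
      ultimately obtain w where w: "w \<in> space_of q" "w \<in> nbhd (known_ranks q) (\<lambda>c. c) u N" "fst w = fst v"
        "\<forall>k<K. snd w k = snd v k" "\<forall>(c, A)\<in>P. true_at (snd w) c A"
        "\<forall>c A. to_nat (c :: nat, A) < K \<longrightarrow> visible w A = visible v A"
        using dense_extension[OF union_class(3,4) space_of_F[OF v(2)] v(1)[unfolded W_def] union_class(2), of P K] by blast
      have *: "true_at (snd w) (if visible v A then c else min_rank c b') A" if "to_nat (c, A) < K" "true_at (snd v) c A" for c A
      proof -
        have "(if visible v A then c else min_rank c b', A) \<in> P"
          unfolding P_def by (rule image_eqI[where x = "(c, A)"]) (use that in auto)
        then show ?thesis using w(5) by blast
      qed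
      then have "true_at (snd w) c A" if "to_nat (c, A) < K" "true_at (snd v) c A" "visible v A" for c A
        using that by metis
      moreover have "true_at (snd w) (min_rank c b') A" if "to_nat (c, A) < K" "true_at (snd v) c A" "\<not> visible v A" for c A
        using that * by metis
      ultimately have "w \<in> nbhd (known_ranks q') (\<lambda>c. min_rank c b') v K"
        using w(3,4,6) unfolding nbhd_def mem_Collect_eq by simp
      then show ?thesis using w(1,2) by (auto simp: V_def)
    qed
    ultimately show False using M.is_open_not_meager by blast
  qed
  then have "M'.meager (\<Union>n. W \<inter> {z. embed z \<in> A n})" by (rule M'.meager_UN)
  then show ?case by (rule M'.meager_subset) (auto simp: W_def)
qed

section \<open>Exchanging the two branches\<close>

text \<open>Follows the labels of true statements from \<open>s @ [b]\<close> on. At points of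
  \<open>G s\<close> all true statements at a string carry the same label; the least one is chosen
  because it is the one observed by \<open>Rt\<close>.\<close>

primrec label_path :: "(nat \<Rightarrow> bool) \<Rightarrow> bool list \<Rightarrow> bool \<Rightarrow> nat \<Rightarrow> bool list" where
  "label_path x s b 0 = s @ [b]"
| "label_path x s b (Suc m) = label_path x s b m @ [label x (label_path x s b m) (LEAST n. T x (label_path x s b m) n)]"

definition label_branch :: "(nat \<Rightarrow> bool) \<Rightarrow> bool list \<Rightarrow> bool \<Rightarrow> nat \<Rightarrow> bool" where
  "label_branch x s b k = label_path x s b k ! k"

definition twin :: "bool list \<Rightarrow> point \<Rightarrow> point" where
  "twin s z = (label_branch (snd z) s (\<not> fst z (length s)), snd z)"

lemma length_label_path [simp]: "length (label_path x s b m) = Suc (length s + m)"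
  by (induction m) auto

lemma label_path_nth: "m \<le> m' \<Longrightarrow> k \<le> length s + m \<Longrightarrow> label_path x s b m' ! k = label_path x s b m ! k"
  by (induction m' rule: dec_induct) (auto simp: nth_append)

lemma label_branch_label_path: "k \<le> length s + m \<Longrightarrow> label_branch x s b k = label_path x s b m ! k"
  unfolding label_branch_def using label_path_nth[of k "max k m" k s x b] label_path_nth[of m "max k m" k s x b] by simp

lemma on_branch_label_branch: "on_branch (label_branch x s b) (label_path x s b m)"
  by (simp add: on_branch_def label_branch_label_path[of _ _ m])

lemma label_branch_bit: "label_branch x s b (length s) = b" and label_branch_below: "k < length s \<Longrightarrow> label_branch x s b k = s ! k"
  using label_branch_label_path[of "length s" s 0 x b] label_branch_label_path[of k s 0 x b] by (simp_all add: nth_append)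

lemma label_branch_above: "label_branch x s b (length (label_path x s b m)) = label x (label_path x s b m) (LEAST n. T x (label_path x s b m) n)"
proof -
  have "label_branch x s b (length (label_path x s b m)) = label_path x s b (Suc m) ! length (label_path x s b m)"
    by (rule label_branch_label_path) simp
  then show ?thesis by (simp only: label_path.simps nth_append_length)
qed

lemma on_branch_unique: "on_branch i s \<Longrightarrow> on_branch i s' \<Longrightarrow> length s = length s' \<Longrightarrow> s = s'"
  by (auto simp: on_branch_def intro: nth_equalityI)

text \<open>Every string on the branch except \<open>s\<close> has a true statement, whose label is
  the next bit by membership in \<open>F\<close>.\<close>

lemma G_label_branch: assumes "z \<in> G s" shows "fst z = label_branch (snd z) s (fst z (length s))"
proof -
  have on_branch: "on_branch (fst z) (label_path (snd z) s (fst z (length s)) m)" for m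
  proof (induction m)
    case 0 then show ?case using assms by (auto simp: G_def on_branch_def nth_append less_Suc_eq)
  next
    case (Suc m)
    let ?s = "label_path (snd z) s (fst z (length s)) m"
    have "?s \<noteq> s" by (metis length_label_path less_irrefl less_Suc_eq_le le_add1)
    then have "\<exists>n. T (snd z) ?s n" using assms by (simp add: G_def)
    then have "T (snd z) ?s (LEAST n. T (snd z) ?s n)" by (rule LeastI_ex)
    then have "label (snd z) ?s (LEAST n. T (snd z) ?s n) = fst z (length ?s)"
      using Suc assms unfolding G_def F_def by blast
    then show ?case using Suc by (auto simp: on_branch_def nth_append less_Suc_eq)
  qed
  show ?thesis
  proof
    fix k show "fst z k = label_branch (snd z) s (fst z (length s)) k"
      using on_branch[of k] by (auto simp: on_branch_def label_branch_def)
  qed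
qed

text \<open>As \<open>x\<close> is unchanged, only the new branch matters. Up to \<open>s\<close> it
  agrees with the old one; beyond \<open>s\<close> it was built from labels, which by
  \<open>cons\<close> do not depend on the true statement chosen; and \<open>s\<close>, the only
  string without true statements, lies on it.\<close>

lemma twin_G: assumes z: "z \<in> G s" shows "twin s z \<in> G s"
proof -
  define i where "i = fst z"
  define x where "x = snd z"
  define i' where "i' = label_branch x s (\<not> i (length s))"
  have sz: "twin s z = (i', x)" by (simp add: twin_def i_def x_def i'_def)
  have zF: "\<And>s n. on_branch i s \<Longrightarrow> T x s n \<Longrightarrow> label x s n = i (length s)"
    "\<And>s n m. \<not> on_branch i s \<Longrightarrow> T x s n \<Longrightarrow> T x s m \<Longrightarrow> label x s n = label x s m"
    and zG: "on_branch i s" "\<And>n. \<not> T x s n" "\<And>s'. s' \<noteq> s \<Longrightarrow> \<exists>n. T x s' n"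
    using z unfolding G_def F_def i_def x_def by blast+
  have below: "i' k = i k" if "k < length s" for k using zG(1) label_branch_below[OF that] that by (simp add: i'_def on_branch_def)
  have on_branch': "on_branch i' s" using zG(1) below by (auto simp: on_branch_def)
  have cons: "label x t n = label x t m" if "T x t n" "T x t m" for t n m
  proof (cases "on_branch i t")
    case True then show ?thesis using zF(1)[OF True that(1)] zF(1)[OF True that(2)] by simp
  next
    case False then show ?thesis using zF(2) that by blast
  qed
  have l1: "label x t n = i' (length t)" if t: "on_branch i' t" "T x t n" for t n
  proof -
    consider "length t < length s" | "length t = length s" | m where "length t = Suc (length s + m)"
      by (metis less_imp_Suc_add linorder_neqE_nat)
    then show ?thesis
    proof cases
      case 1
      then have "on_branch i t" using t(1) below by (auto simp: on_branch_def)
      then show ?thesis using zF(1) t(2) below[OF 1] by simp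
    next
      case 2
      then have "t = s" using on_branch_unique[OF t(1) on_branch'] by blast
      then show ?thesis using zG(2) t(2) by blast
    next
      case 3
      then have tm: "t = label_path x s (\<not> i (length s)) m"
        using on_branch_unique[OF t(1)[unfolded i'_def] on_branch_label_branch] by simp
      have "T x t (LEAST n. T x t n)" using t(2) by (rule LeastI)
      then have "label x t n = label x t (LEAST n. T x t n)" using cons t(2) by blast
      also have "\<dots> = i' (length t)" using label_branch_above[of x s _ m] tm unfolding i'_def by metis
      finally show ?thesis .
    qed
  qed
  have l2: "\<exists>n. T x t n" if "\<not> on_branch i' t" for t
  proof -
    have "t \<noteq> s" using that on_branch' by blast
    then show ?thesis by (rule zG(3))
  qed
  have "(i', x) \<in> F" unfolding F_def mem_Collect_eq fst_conv snd_conv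
    by (intro conjI allI impI; (elim conjE)?) (rule l1 l2 cons; assumption)+
  then show ?thesis using on_branch' zG unfolding G_def sz by simp
qed

lemma twin_twin: assumes "z \<in> G s" shows "twin s (twin s z) = z"
  using G_label_branch[OF assms] by (simp add: twin_def label_branch_bit prod_eq_iff)

lemma twin_neq: "fst (twin s z) (length s) \<noteq> fst z (length s)"
  by (simp add: twin_def label_branch_bit)

text \<open>Strings on the path are longer than \<open>s\<close>, so their least true statements are
  observed even on the branch. This is the purpose of \<open>E = - {s}\<close>.\<close>

lemma label_path_agree:
  "\<forall>\<^sub>F K in sequentially. \<forall>w. (\<forall>p<K. obs_seq UNIV (- {s}) w p = obs_seq UNIV (- {s}) v p) \<longrightarrow> label_path (snd w) s b m = label_path (snd v) s b m"
proof (induction m)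
  case 0 then show ?case by simp
next
  case (Suc m)
  define t where "t = label_path (snd v) s b m"
  define n where "n = (LEAST n. T (snd v) t n)"
  let ?S = "{Rt t, Xb (to_nat (Inl (t, n) :: (bool list \<times> nat) + (node \<times> nat)))}"
  have "length t \<noteq> length s" by (simp add: t_def)
  then have ts: "t \<noteq> s" by blast
  have *: "(LEAST n. T (snd w) t n) = n \<and> label (snd w) t n = label (snd v) t n"
    if "\<forall>p\<in>?S. obs UNIV (- {s}) w p = obs UNIV (- {s}) v p" for w
    using that ts by (simp add: obs_def n_def label_def of_bool_eq_iff)
  have "finite ?S" by simp
  from obs_seq_agree[OF this, of UNIV "- {s}" v] Suc show ?case
  proof eventually_elim
    case (elim K)
    show ?case
    proof (intro allI impI)
      fix w assume w: "\<forall>p<K. obs_seq UNIV (- {s}) w p = obs_seq UNIV (- {s}) v p"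
      have "label_path (snd w) s b m = t" unfolding t_def using elim(2) w by blast
      moreover have "(LEAST n. T (snd w) t n) = n \<and> label (snd w) t n = label (snd v) t n"
        using * elim(1) w by blast
      ultimately show "label_path (snd w) s b (Suc m) = label_path (snd v) s b (Suc m)" by (simp add: t_def[symmetric] n_def[symmetric])
    qed
  qed
qed

text \<open>With all ranks and all strings but \<open>s\<close> observed, only the bits
  \<open>Ib\<close> depend on the branch, and \<open>Rt s\<close> is constantly 0 because
  \<open>s\<close> stays on the branch.\<close>

lemma twin_obs:
  assumes v: "v \<in> G s"
  shows "\<forall>\<^sub>F K in sequentially. \<forall>w\<in>G s. (\<forall>p<K. obs_seq UNIV (- {s}) w p = obs_seq UNIV (- {s}) v p) \<longrightarrow>
    obs UNIV (- {s}) (twin s w) p = obs UNIV (- {s}) (twin s v) p"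
proof (cases "\<exists>k. p = Ib k")
  case True
  then obtain k where p: "p = Ib k" by blast
  define b where "b = (\<not> fst v (length s))"
  have *: "fst w (length s) = fst v (length s)" if "obs UNIV (- {s}) w (Ib (length s)) = obs UNIV (- {s}) v (Ib (length s))" for w
    using that by (simp add: obs_def of_bool_eq_iff)
  have "finite {Ib (length s)}" by simp
  from obs_seq_agree[OF this, of UNIV "- {s}" v] label_path_agree[of s v b k] show ?thesis
  proof eventually_elim
    case (elim K)
    show ?case
    proof (intro ballI impI)
      fix w assume w: "\<forall>p<K. obs_seq UNIV (- {s}) w p = obs_seq UNIV (- {s}) v p"
      have "fst w (length s) = fst v (length s)" "label_path (snd w) s b k = label_path (snd v) s b k"
        using elim w * by blast+
      then show "obs UNIV (- {s}) (twin s w) p = obs UNIV (- {s}) (twin s v) p"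
        by (simp add: obs_def p twin_def label_branch_def b_def)
    qed
  qed
next
  case False
  have eq: "obs UNIV (- {s}) (twin s w) p = (if p = Rt s then 0 else obs UNIV (- {s}) w p)" if "w \<in> G s" for w
  proof -
    have "on_branch (fst (twin s w)) s" using twin_G[OF that] by (simp add: G_def)
    then show ?thesis using False by (cases p) (auto simp: obs_def twin_def)
  qed
  have "finite {p}" by simp
  from obs_seq_agree[OF this, of UNIV "- {s}" v] show ?thesis
  proof (rule eventually_mono, intro ballI impI)
    fix K w assume K: "\<forall>w. (\<forall>p<K. obs_seq UNIV (- {s}) w p = obs_seq UNIV (- {s}) v p) \<longrightarrow>
        (\<forall>p\<in>{p}. obs UNIV (- {s}) w p = obs UNIV (- {s}) v p)"
      and w: "w \<in> G s" "\<forall>p<K. obs_seq UNIV (- {s}) w p = obs_seq UNIV (- {s}) v p"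
    have "obs UNIV (- {s}) w p = obs UNIV (- {s}) v p" using K w(2) by blast
    then show "obs UNIV (- {s}) (twin s w) p = obs UNIV (- {s}) (twin s v) p"
      unfolding eq[OF w(1)] eq[OF v] by simp
  qed
qed

lemma twin_continuous:
  assumes v: "v \<in> G s"
  shows "\<exists>K. \<forall>w\<in>code_space.cyl (G s) (obs_seq UNIV (- {s})) v K.
    twin s w \<in> code_space.cyl (G s) (obs_seq UNIV (- {s})) (twin s v) N"
proof -
  have "\<forall>\<^sub>F K in sequentially. \<forall>q\<in>{..<N}. \<forall>w\<in>G s. (\<forall>p<K. obs_seq UNIV (- {s}) w p = obs_seq UNIV (- {s}) v p) \<longrightarrow>
    obs UNIV (- {s}) (twin s w) (from_nat q) = obs UNIV (- {s}) (twin s v) (from_nat q)"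
    using twin_obs[OF v] by (intro eventually_ball_finite) auto
  from eventually_sequentially_ex[OF this] show ?thesis
    unfolding code_space.cyl_def[OF code_space_G] obs_seq_def[symmetric] using twin_G by blast
qed

text \<open>The exchange alters the branch only from position \<open>length s\<close> on, whereas
  \<open>visible\<close> reads it up to and including position \<open>length (fst A)\<close>; hence
  the strict inequality.\<close>

lemma twin_nbhd:
  assumes w: "w \<in> G s" "w \<in> nbhd D t u N" and s: "N \<le> length s"
    "\<And>c A. to_nat (c :: nat, A) < N \<Longrightarrow> length (fst (A :: node)) < length s"
  shows "twin s w \<in> nbhd D t u N"
proof -
  have below: "fst (twin s w) k = fst w k" if "k < length s" for k
    using w(1) label_branch_below[OF that] that by (simp add: twin_def G_def on_branch_def)
  have visible: "visible (twin s w) A = visible w A" if "to_nat (c :: nat, A) < N" for c A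
    using s(2)[OF that] below by (simp add: visible_def on_branch_def) (simp add: twin_def)
  have sn: "snd (twin s w) = snd w" by (simp add: twin_def)
  show ?thesis using w(2) below visible s(1) unfolding nbhd_def mem_Collect_eq sn
    by auto
qed

text \<open>The string \<open>s\<close> is taken on the branch of \<open>u\<close>, longer than all
  strings mentioned by the neighbourhood, so the exchange disturbs none of its facts.\<close>

lemma twin_neighbourhood:
  assumes u: "u \<in> F"
  shows "\<exists>s. (\<exists>w\<in>G s. w \<in> nbhd {c. lt c a} (\<lambda>c. c) u N)
    \<and> (\<forall>t. \<forall>w\<in>G s. w \<in> nbhd {c. lt c a} t u N \<longrightarrow> twin s w \<in> nbhd {c. lt c a} t u N)"
proof -
  have "finite ((\<lambda>q. length (fst (snd q))) ` {q :: nat \<times> node. to_nat q < N})"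
    by (rule finite_imageI[OF finite_codes])
  then obtain m0 where m0: "\<forall>k\<in>(\<lambda>q. length (fst (snd q))) ` {q :: nat \<times> node. to_nat q < N}. k < m0"
    using finite_nat_set_iff_bounded by meson
  define s where "s = map (fst u) [0..<max m0 N]"
  have on_branch: "on_branch (fst u) s" by (simp add: s_def on_branch_def)
  have len: "N \<le> length s" "length (fst A) < length s" if "to_nat (c :: nat, A) < N" for c and A :: node
  proof -
    have "length (fst A) \<in> (\<lambda>q. length (fst (snd q))) ` {q :: nat \<times> node. to_nat q < N}"
      using that by force
    then have "length (fst A) < m0" using m0 by blast
    then show "length (fst A) < length s" by (simp add: s_def)
  qed (simp add: s_def)
  have Ns: "N \<le> length s" by (simp add: s_def)
  define P where "P = {(c, A). to_nat (c, A) < N \<and> true_at (snd u) c A \<and> (visible u A \<or> lt c a)}"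
  have PD: "true_at (snd u) c A \<and> (visible u A \<or> lt c a)" if "(c, A) \<in> P" for c A
    using that by (simp add: P_def)
  obtain K where K: "K \<ge> N" "\<And>v w c A. \<lbrakk>fst w = fst v; \<forall>k<K. snd w k = snd v k;
      to_nat (c :: nat, A) < N\<rbrakk> \<Longrightarrow> visible w A = visible v A"
  proof -
    have "\<forall>\<^sub>F K in sequentially. K \<ge> N \<and> (\<forall>v w. fst w = fst v \<and> (\<forall>k<K. snd w k = snd v k) \<longrightarrow>
     (\<forall>c A. to_nat (c :: nat, A) < N \<longrightarrow> visible w A = visible v A))"
      using visible_agree[of N] eventually_ge_at_top[of N] by eventually_elim blast
    from eventually_sequentially_ex[OF this] show thesis using that by blast
  qed
  have "\<exists>w\<in>space_of (Some s). fst w = fst u \<and> (\<forall>k<K. snd w k = snd u k) \<and> (\<forall>(c, A)\<in>P. true_at (snd w) c A)"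
  proof (rule realize_facts[OF u])
    show "on_branch (fst u) t" if "t \<in> rootless (Some s)" for t using that on_branch by simp
    show "finite P" by (rule finite_subset[OF _ finite_codes[of N]]) (auto simp: P_def)
    show "\<not> leaf_at (snd u) A j" if "(c, A) \<in> P" for c A j using PD[OF that] true_at_no_leaf by blast
    show "lt d (child_rank j)" if "(c, A) \<in> P" "(d, child A j) \<in> P" "lt (child_rank j) c" for c A d j
      using PD[OF that(1)] PD[OF that(2)] true_at_child that(3) by blast
    show "t \<notin> rootless (Some s) \<and> (if on_branch (fst u) t then \<not> visible u (t, n, []) else T (snd u) t n)"
      if "(c, (t, n, [])) \<in> P" "\<not> lt c a" for c t n
    proof -
      \<comment> \<open>A fact of full rank in \<open>P\<close> is visible and true, so it lies off
        the branch and does not concern \<open>s\<close>.\<close>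
      have t: "T (snd u) t n" "visible u (t, n, [])" using PD[OF that(1)] that(2) true_at_mono by blast+
      then have "\<not> on_branch (fst u) t" using u by (auto simp: F_def visible_def)
      then show ?thesis using t on_branch by auto
    qed
  qed
  then obtain w where w: "w \<in> G s" "fst w = fst u" "\<forall>k<K. snd w k = snd u k" "\<forall>(c, A)\<in>P. true_at (snd w) c A"
    by auto
  have "w \<in> nbhd {c. lt c a} (\<lambda>c. c) u N"
    unfolding nbhd_def mem_Collect_eq
  proof (intro conjI allI impI)
    show "fst w k = fst u k" "snd w k = snd u k" if "k < N" for k using w(2,3) that K(1) by auto
    show "visible w A = visible u A" if "to_nat (c, A) < N" for c :: nat and A using K(2)[OF w(2,3) that] .
    have wP: "true_at (snd w) c A" if "to_nat (c, A) < N" "true_at (snd u) c A" "visible u A \<or> lt c a" for c A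
    proof -
      have "(c, A) \<in> P" using that by (simp add: P_def)
      then show ?thesis using w(4) by blast
    qed
    then show "true_at (snd w) c A" if "to_nat (c, A) < N" "true_at (snd u) c A" "visible u A" for c A using that by blast
    show "true_at (snd w) c A" if "to_nat (c, A) < N" "true_at (snd u) c A" "lt c a" for c A
      using that wP by blast
  qed
  moreover have "twin s w \<in> nbhd {c. lt c a} t u N" if "w \<in> G s" "w \<in> nbhd {c. lt c a} t u N" for t w
    by (rule twin_nbhd[OF that Ns]) (rule len(2))
  ultimately show ?thesis using w(1) by blast
qed

section \<open>Impossibility of a cover\<close>

lemma F_nonempty: "\<exists>z. z \<in> F"
proof (rule extension[of "{}" "\<lambda>_. False" "{}" "\<lambda>_. False" 0])
  fix x' assume x': "\<And>s n. T x' s n \<Longrightarrow> s \<notin> {} \<and> label x' s n = False" "\<And>s. s \<notin> {} \<Longrightarrow> \<exists>n. T x' s n"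
  then have "(\<lambda>_. False, x') \<in> F" by (auto simp: F_def)
  then show ?thesis by blast
qed auto

lemma fst_embed [simp]: "fst (embed z) = snd z"
  by (simp add: embed_def)

lemma embed_inj: "embed z = embed z' \<Longrightarrow> z = z'"
proof -
  assume eq: "embed z = embed z'"
  then have "case_nat 0 (obs_seq {} {} z) (Suc (to_nat (Ib k))) = case_nat 0 (obs_seq {} {} z') (Suc (to_nat (Ib k)))" for k
    by (simp only: embed_def prod.inject)
  then have "fst z k = fst z' k" for k by (simp add: obs_seq_def obs_def of_bool_eq_iff)
  moreover have "snd z = snd z'" using eq by (metis fst_embed)
  ultimately show ?thesis by (simp add: prod_eq_iff fun_eq_iff)
qed

theorem not_covered:
  assumes B: "\<And>n :: nat. Sigma_class CB_top R a (B n)"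
    and thin: "\<And>n x y1 y2. (x, y1) \<in> B n \<Longrightarrow> (x, y2) \<in> B n \<Longrightarrow> y1 = y2"
    and cover: "embed ` F \<subseteq> (\<Union>n. B n)"
  shows False
proof -
  interpret M: code_space "space_of None" "obs_seq (known_ranks None) (rooted None)" by (rule code_space_space_of)
  have no_twins: False if "embed w \<in> B n" "embed (twin s w) \<in> B n" for n s w
  proof -
    have "snd (embed (twin s w)) = snd (embed w)"
      using thin[of "snd w" _ n] that by (metis fst_embed prod.collapse twin_def snd_conv)
    then have "embed (twin s w) = embed w" by (simp add: prod_eq_iff twin_def)
    then have "twin s w = w" by (rule embed_inj)
    then show False using twin_neq by metis
  qed
  obtain z where z: "z \<in> F" using F_nonempty by blast
  have "\<exists>n. \<not> M.meager {v. embed v \<in> B n}"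
  proof (rule ccontr)
    assume "\<not> ?thesis"
    then have "M.meager (\<Union>n. {v. embed v \<in> B n})" by (intro M.meager_UN) blast
    then have "M.meager (M.cyl z 0)" by (rule M.meager_subset) (use cover in auto)
    then show False using M.Baire z by simp
  qed
  then obtain n where n: "\<not> M.meager {v. embed v \<in> B n}" by blast
  show False using B[of n]
  proof cases
    case open_class
    obtain u where u: "u \<in> F" "embed u \<in> B n"
      using n M.meager_subset[OF M.meager_empty, of "{v. embed v \<in> B n}"] unfolding space_of.simps by blast
    obtain N where N: "\<forall>v\<in>nbhd {} (\<lambda>c. c) u N. embed v \<in> B n"
      using eventually_sequentially_ex[OF embed_continuous[OF open_class u(2,1)]] by blast
    have sub: "nbhd {c. lt c a} (\<lambda>c. c) u N \<subseteq> nbhd {} (\<lambda>c. c) u N" by (auto simp: nbhd_def)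
    show False using twin_neighbourhood[OF u(1), of N] no_twins N sub by blast
  next
    case (union_class A)
    have "\<exists>m. \<not> M.meager {v. embed v \<in> A m}"
    proof (rule ccontr)
      assume "\<not> ?thesis"
      then have "M.meager (\<Union>m. {v. embed v \<in> A m})" by (intro M.meager_UN) blast
      then have "M.meager {v. embed v \<in> B n}" by (rule M.meager_subset) (use union_class(1) in blast)
      then show False using n by blast
    qed
    then obtain m where m: "\<not> M.meager {v. embed v \<in> A m}" by blast
    obtain b where b: "lt b a" "Sigma_class CB_top R b (UNIV - A m)" using union_class(2)[of m] by auto
    have "M.decided {z. embed z \<in> A m}"
      by (rule M.decided_cong[OF M.decided_Compl[OF decided_embed[OF b(2)]]]) auto
    moreover have "M.is_open UNIV" unfolding M.is_open_def by blast
    moreover have "\<not> M.meager (UNIV \<inter> {z. embed z \<in> A m})" unfolding Int_UNIV_left by (rule m)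
    ultimately obtain u K where u': "u \<in> space_of None" "M.meager (M.cyl u K - {z. embed z \<in> A m})"
      using M.comeager_cyl[of "{z. embed z \<in> A m}" UNIV] by blast
    then have u: "u \<in> F" by simp
    obtain N where N: "nbhd (known_ranks None) (\<lambda>c. c) u N \<inter> space_of None \<subseteq> M.cyl u K"
      using eventually_sequentially_ex[OF nbhd_cyl[OF u'(1), of K]] by blast
    obtain s where s: "\<exists>w\<in>G s. w \<in> nbhd {c. lt c a} (\<lambda>c. c) u N"
      "\<And>t w. w \<in> G s \<Longrightarrow> w \<in> nbhd {c. lt c a} t u N \<Longrightarrow> twin s w \<in> nbhd {c. lt c a} t u N"
      using twin_neighbourhood[OF u, of N] by blast
    interpret M': code_space "space_of (Some s)" "obs_seq (known_ranks (Some s)) (rooted (Some s))" by (rule code_space_space_of)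
    define W where "W = nbhd (known_ranks None) (\<lambda>c. min_rank c b) u N"
    have "M.meager {v \<in> nbhd (known_ranks None) (\<lambda>c. c) u N. embed v \<in> UNIV - A m}"
      using u'(2) by (rule M.meager_subset) (use N in blast)
    \<comment> \<open>The transfer concerns the complement of \<open>A m\<close>, whose class index
      \<open>b\<close> is below \<open>a\<close>.\<close>
    then have 1: "M'.meager {v \<in> W. embed v \<in> UNIV - A m}"
      unfolding W_def by (rule transfer[OF b(2,1) u'(1), rotated]) simp
    have 2: "M'.meager (twin s -` {v \<in> W. embed v \<in> UNIV - A m})"
    proof (rule M'.meager_vimage_involution[OF _ _ _ 1])
      show "\<exists>K. \<forall>w\<in>M'.cyl v K. twin s w \<in> M'.cyl (twin s v) N" if "v \<in> space_of (Some s)" for v N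
        using twin_continuous that unfolding space_of.simps known_ranks.simps rooted.simps by blast
    qed (use twin_G twin_twin in simp_all)
    have op: "M'.is_open W" unfolding W_def by (rule is_open_nbhd) (rule min_rank_known_ranks[OF b(1)])
    obtain w where w: "w \<in> G s" "w \<in> nbhd {c. lt c a} (\<lambda>c. c) u N" using s(1) by blast
    have "w \<in> W" using w(2) true_at_min_rank unfolding W_def nbhd_def known_ranks.simps by blast
    moreover have "w \<in> space_of (Some s)" using w(1) by simp
    ultimately have "\<not> M'.meager W" using M'.is_open_not_meager[OF op] by blast
    \<comment> \<open>Outside the two meager sets a point of \<open>W\<close> lies in
      \<open>A m\<close> together with its twin, since the exchange maps
      \<open>W \<inter> G s\<close> into \<open>W\<close>.\<close>
    moreover have "M'.meager W" if "\<And>v. v \<in> G s \<Longrightarrow> v \<in> W \<Longrightarrow> embed v \<in> A m \<Longrightarrow> embed (twin s v) \<in> A m \<Longrightarrow> False"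
      using M'.meager_Un[OF 1 2] by (rule M'.meager_subset) (use that s(2) in \<open>unfold W_def space_of.simps known_ranks.simps, blast\<close>)
    ultimately obtain v where "embed v \<in> A m" "embed (twin s v) \<in> A m" by blast
    then have "embed v \<in> B n" "embed (twin s v) \<in> B n" using union_class(1) by auto
    then show False by (rule no_twins)
  qed
qed

end

section \<open>Filling up the sections\<close>

text \<open>Such an \<open>h\<close> may be discontinuous, yet its graph is a closed set with
  exactly one point over each \<open>x\<close>.\<close>

definition closed_graph :: "((nat \<Rightarrow> bool) \<Rightarrow> nat \<Rightarrow> nat) \<Rightarrow> bool" where
  "closed_graph h \<longleftrightarrow> (\<forall>X x Y. (\<forall>m. \<forall>\<^sub>F k in sequentially. X k m = x m) \<longrightarrow>
     (\<forall>m. \<forall>\<^sub>F k in sequentially. h (X k) m = Y m) \<longrightarrow> h x = Y)"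

text \<open>In fact these are exactly the Borel predicates.\<close>

definition witnessed :: "((nat \<Rightarrow> bool) \<Rightarrow> bool) \<Rightarrow> bool" where
  "witnessed Q \<longleftrightarrow> (\<exists>h. closed_graph h \<and> (\<forall>x. Q x \<longleftrightarrow> h x 0 = 0))"

lemma closed_graphD:
  assumes "closed_graph h" "\<And>m. \<forall>\<^sub>F k in sequentially. X k m = x m" "\<And>m. \<forall>\<^sub>F k in sequentially. h (X k) m = Y m"
  shows "h x = Y"
  using assms unfolding closed_graph_def by blast

lemma witnessed_coord: "witnessed (\<lambda>x. x k)"
proof -
  define h :: "(nat \<Rightarrow> bool) \<Rightarrow> nat \<Rightarrow> nat" where "h x m = of_bool (\<not> x k)" for x m
  have "closed_graph h" unfolding closed_graph_def
  proof (intro allI impI ext)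
    fix X :: "nat \<Rightarrow> nat \<Rightarrow> bool" and x Y m
    assume "\<forall>m. \<forall>\<^sub>F k in sequentially. X k m = x m" "\<forall>m. \<forall>\<^sub>F k in sequentially. h (X k) m = Y m"
    then have "\<forall>\<^sub>F j in sequentially. X j k = x k" "\<forall>\<^sub>F k in sequentially. h (X k) m = Y m" by blast+
    then have "\<forall>\<^sub>F j in sequentially. h x m = Y m" by eventually_elim (simp add: h_def)
    then show "h x m = Y m" by simp
  qed
  then show ?thesis unfolding witnessed_def by (intro exI[of _ h]) (simp add: h_def)
qed

lemma witnessed_const: "witnessed (\<lambda>x. c)"
proof -
  have "closed_graph (\<lambda>_ _. of_bool (\<not> c))"
    unfolding closed_graph_def by (auto simp: fun_eq_iff)
  then show ?thesis unfolding witnessed_def by (intro exI[of _ "\<lambda>_ _. of_bool (\<not> c)"]) simp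
qed

text \<open>The flag is put in front of the old value, which is kept because the flag alone need not
  have a closed graph.\<close>

lemma witnessed_not: assumes "witnessed Q" shows "witnessed (\<lambda>x. \<not> Q x)"
proof -
  obtain h where h: "closed_graph h" "\<And>x. Q x \<longleftrightarrow> h x 0 = 0" using assms by (auto simp: witnessed_def)
  define h' where "h' x = case_nat (of_bool (h x 0 = 0)) (h x)" for x
  have "closed_graph h'" unfolding closed_graph_def
  proof (intro allI impI)
    fix X :: "nat \<Rightarrow> nat \<Rightarrow> bool" and x Y
    assume X: "\<forall>m. \<forall>\<^sub>F k in sequentially. X k m = x m" and Y: "\<forall>m. \<forall>\<^sub>F k in sequentially. h' (X k) m = Y m"
    have evidence: "\<forall>\<^sub>F k in sequentially. h (X k) m = Y (Suc m)" for m
      using Y[rule_format, of "Suc m"] by (simp add: h'_def)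
    have hx: "h x = (\<lambda>m. Y (Suc m))" by (rule closed_graphD[OF h(1) X[rule_format] evidence])
    have "\<forall>\<^sub>F k in sequentially. of_bool (h x 0 = 0) = Y 0"
      using Y[rule_format, of 0] Y[rule_format, of "Suc 0"] by eventually_elim (simp add: h'_def hx)
    then show "h' x = Y" by (auto simp: h'_def hx fun_eq_iff split: nat.split)
  qed
  then show ?thesis unfolding witnessed_def by (intro exI[of _ h']) (simp add: h'_def h(2))
qed

text \<open>The values of all \<open>h n\<close> are interleaved behind a leading entry. In a limit
  the entry 0 is correct because each \<open>Q n\<close> converges separately; an entry
  \<open>Suc n\<close> is correct because it depends on \<open>Q 0\<close> to \<open>Q n\<close>
  only.\<close>

lemma witnessed_all_nat:
  fixes Q :: "nat \<Rightarrow> (nat \<Rightarrow> bool) \<Rightarrow> bool"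
  assumes "\<And>n. witnessed (Q n)" shows "witnessed (\<lambda>x. \<forall>n. Q n x)"
proof -
  obtain h where h: "\<And>n. closed_graph (h n)" "\<And>n x. Q n x \<longleftrightarrow> h n x 0 = 0"
    using assms unfolding witnessed_def by metis
  define h' where "h' x = case_nat (if \<forall>n. Q n x then 0 else Suc (LEAST n. \<not> Q n x))
     (\<lambda>m. h (fst (prod_decode m)) x (snd (prod_decode m)))" for x
  have "closed_graph h'" unfolding closed_graph_def
  proof (intro allI impI)
    fix X :: "nat \<Rightarrow> nat \<Rightarrow> bool" and x Y
    assume X: "\<forall>m. \<forall>\<^sub>F k in sequentially. X k m = x m" and Y: "\<forall>m. \<forall>\<^sub>F k in sequentially. h' (X k) m = Y m"
    have evidence: "\<forall>\<^sub>F k in sequentially. h n (X k) m = Y (Suc (prod_encode (n, m)))" for n m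
      using Y[rule_format, of "Suc (prod_encode (n, m))"] by (simp add: h'_def)
    have hx: "h n x = (\<lambda>m. Y (Suc (prod_encode (n, m))))" for n
      by (rule closed_graphD[OF h(1) X[rule_format] evidence])
    have Q: "\<forall>\<^sub>F k in sequentially. Q n (X k) = Q n x" for n
      using evidence[of n 0] by eventually_elim (simp add: h(2) hx)
    have "h' x 0 = Y 0"
    proof (cases "Y 0")
      case 0
      have "Q n x" for n
      proof -
        have "\<forall>\<^sub>F k in sequentially. Q n x"
          using Q[of n] Y[rule_format, of 0] by eventually_elim (auto simp: h'_def 0 split: if_splits)
        then show ?thesis by simp
      qed
      then show ?thesis by (simp add: h'_def 0)
    next
      case (Suc n)
      have "\<forall>\<^sub>F k in sequentially. \<forall>m\<in>{..n}. Q m (X k) = Q m x" using Q by (intro eventually_ball_finite) auto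
      then have "\<forall>\<^sub>F k in sequentially. \<not> Q n x \<and> (LEAST n. \<not> Q n x) = n"
        using Y[rule_format, of 0]
      proof eventually_elim
        case (elim k)
        then have l: "\<not> (\<forall>n. Q n (X k))" "(LEAST n. \<not> Q n (X k)) = n"
          by (auto simp: h'_def Suc split: if_splits)
        then have n: "\<not> Q n (X k)" using LeastI_ex[of "\<lambda>n. \<not> Q n (X k)"] by auto
        then have "(LEAST n. \<not> Q n (X k)) = (LEAST n. \<not> Q n x)"
          by (rule Least_cong_upto) (use elim(1) in auto)
        then show ?case using n l elim(1) by auto
      qed
      then show ?thesis by (auto simp: h'_def Suc)
    qed
    then show "h' x = Y" by (auto simp: h'_def hx fun_eq_iff split: nat.split)
  qed
  then show ?thesis unfolding witnessed_def by (intro exI[of _ h']) (simp add: h'_def)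
qed

lemma witnessed_all:
  fixes Q :: "'a :: countable \<Rightarrow> (nat \<Rightarrow> bool) \<Rightarrow> bool"
  assumes "\<And>n. witnessed (Q n)" shows "witnessed (\<lambda>x. \<forall>n. Q n x)"
proof -
  have "witnessed (\<lambda>x. \<forall>n. Q (from_nat n) x)" using assms by (intro witnessed_all_nat) auto
  moreover have "(\<forall>n. Q (from_nat n) x) \<longleftrightarrow> (\<forall>n. Q n x)" for x by (metis from_nat_to_nat)
  ultimately show ?thesis by simp
qed

lemma witnessed_ex:
  fixes Q :: "'a :: countable \<Rightarrow> (nat \<Rightarrow> bool) \<Rightarrow> bool"
  assumes "\<And>n. witnessed (Q n)" shows "witnessed (\<lambda>x. \<exists>n. Q n x)"
  using witnessed_not[OF witnessed_all[of "\<lambda>n x. \<not> Q n x"]] witnessed_not[OF assms] by simp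

lemma witnessed_conj: assumes "witnessed P" "witnessed Q" shows "witnessed (\<lambda>x. P x \<and> Q x)"
proof -
  have "witnessed (\<lambda>x. \<forall>b. if b then P x else Q x)"
  proof (rule witnessed_all)
    show "witnessed (\<lambda>x. if b then P x else Q x)" for b using assms by (cases b) auto
  qed
  then show ?thesis by (simp add: all_bool_eq conj_commute)
qed

lemma witnessed_imp: assumes "witnessed P" "witnessed Q" shows "witnessed (\<lambda>x. P x \<longrightarrow> Q x)"
  using witnessed_not[OF witnessed_conj[OF assms(1) witnessed_not[OF assms(2)]]] by simp

lemma witnessed_eq: assumes "witnessed P" "witnessed Q" shows "witnessed (\<lambda>x. P x = Q x)"
proof -
  have "witnessed (\<lambda>x. (P x \<longrightarrow> Q x) \<and> (Q x \<longrightarrow> P x))" by (intro witnessed_conj witnessed_imp assms)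
  moreover have "((P x \<longrightarrow> Q x) \<and> (Q x \<longrightarrow> P x)) = (P x = Q x)" for x by blast
  ultimately show ?thesis by simp
qed

section \<open>Projection along the Cantor space by compactness\<close>

lemma binary_Koenig:
  assumes prefix: "\<And>t m. Q t \<Longrightarrow> Q (take m t)" and levels: "\<And>m. \<exists>t :: bool list. length t = m \<and> Q t"
  shows "\<exists>i. \<forall>m. Q (map i [0..<m])"
proof -
  define good where "good t \<longleftrightarrow> (\<forall>m\<ge>length t. \<exists>t'. length t' = m \<and> take (length t) t' = t \<and> Q t')" for t
  have step: "\<exists>b. good (t @ [b])" if gt: "good t" for t
  proof (rule ccontr)
    assume "\<nexists>b. good (t @ [b])"
    then have "\<forall>b. \<exists>m\<ge>length (t @ [b]). \<not> (\<exists>t'. length t' = m \<and> take (length (t @ [b])) t' = t @ [b] \<and> Q t')"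
      unfolding good_def by blast
    then obtain m where m: "\<And>b. m b \<ge> Suc (length t)"
      "\<And>b t'. length t' = m b \<Longrightarrow> take (Suc (length t)) t' = t @ [b] \<Longrightarrow> \<not> Q t'"
      by (metis length_append_singleton)
    define M where "M = max (m True) (m False)"
    have "M \<ge> length t" using m(1)[of True] by (simp add: M_def)
    then obtain t' where t': "length t' = M" "take (length t) t' = t" "Q t'"
      using gt unfolding good_def by blast
    define b where "b = t' ! length t"
    have lt: "length t < length t'" using t'(1) m(1)[of True] by (simp add: M_def)
    have tk: "take (Suc (length t)) t' = t @ [b]"
      using take_Suc_conv_app_nth[OF lt] t'(2) by (simp add: b_def)
    have "m b \<le> M" by (cases b) (auto simp: M_def)
    then have "length (take (m b) t') = m b" using t'(1) by simp
    moreover have "take (Suc (length t)) (take (m b) t') = t @ [b]" using tk m(1)[of b] by (simp add: min_def)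
    ultimately show False using m(2) prefix[OF t'(3)] by blast
  qed
  have "good []" using levels by (auto simp: good_def)
  then have "\<exists>f. \<forall>n. good (f n) \<and> length (f n) = n \<and> (\<exists>b. f (Suc n) = f n @ [b])"
    using dependent_nat_choice[of "\<lambda>n t. good t \<and> length t = n" "\<lambda>n t t'. \<exists>b. t' = t @ [b]"] step
    by (metis length_append_singleton length_0_conv)
  then obtain f where f: "\<And>n. good (f n)" "\<And>n. length (f n) = n" "\<And>n. \<exists>b. f (Suc n) = f n @ [b]" by blast
  define i where "i k = f (Suc k) ! k" for k
  have "map i [0..<m] = f m" for m
  proof (induction m)
    case 0 then show ?case using f(2)[of 0] by simp
  next
    case (Suc m)
    obtain b where b: "f (Suc m) = f m @ [b]" using f(3) by blast
    have "i m = b" using f(2)[of m] by (simp add: i_def b nth_append)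
    then show ?case using Suc b by simp
  qed
  moreover have "Q (f m)" for m
  proof -
    obtain t' where "length t' = m" "take m t' = f m" "Q t'" using f(1)[of m] f(2)[of m] unfolding good_def by auto
    then show ?thesis by simp
  qed
  ultimately show ?thesis by metis
qed

context ranks
begin

lemma witnessed_true_at: "witnessed (\<lambda>x. true_at x c A)"
proof (induction c arbitrary: A rule: lt_induct)
  case (1 c)
  have "witnessed (\<lambda>x. \<forall>j. \<not> leaf_at x A j \<and> (lt (child_rank j) c \<longrightarrow> \<not> true_at x (child_rank j) (child A j)))"
  proof (intro witnessed_all witnessed_conj witnessed_not)
    show "witnessed (\<lambda>x. leaf_at x A j)" for j unfolding leaf_at_def by (rule witnessed_coord)
    show "witnessed (\<lambda>x. lt (child_rank j) c \<longrightarrow> \<not> true_at x (child_rank j) (child A j))" for j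
      using 1 witnessed_not witnessed_const[of True] by (cases "lt (child_rank j) c") auto
  qed
  then show ?case by (subst true_at.simps)
qed

text \<open>Membership in \<open>F\<close> up to a finite level, so that Koenig's lemma makes the projection Borel.\<close>

definition consistent :: "(nat \<Rightarrow> bool) \<Rightarrow> bool list \<Rightarrow> bool" where
  "consistent x t \<longleftrightarrow> (\<forall>s. length s < length t \<longrightarrow> (if s = take (length s) t
      then \<forall>n. T x s n \<longrightarrow> label x s n = t ! length s
      else (\<exists>n. T x s n) \<and> (\<forall>n m. T x s n \<and> T x s m \<longrightarrow> label x s n = label x s m)))"

lemma witnessed_consistent: "witnessed (\<lambda>x. consistent x t)"
  unfolding consistent_def
proof (intro witnessed_all)
  fix s
  have l: "witnessed (\<lambda>x. label x s n)" for n unfolding label_def by (rule witnessed_coord)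
  have "witnessed (\<lambda>x. if s = take (length s) t
      then \<forall>n. T x s n \<longrightarrow> label x s n = t ! length s
      else (\<exists>n. T x s n) \<and> (\<forall>n m. T x s n \<and> T x s m \<longrightarrow> label x s n = label x s m))"
  proof (cases "s = take (length s) t")
    case True
    show ?thesis unfolding if_P[OF True] by (intro witnessed_all witnessed_imp witnessed_eq witnessed_true_at l witnessed_const)
  next
    case False
    show ?thesis unfolding if_not_P[OF False]
      by (intro witnessed_all witnessed_imp witnessed_conj witnessed_ex witnessed_eq witnessed_true_at l)
  qed
  then show "witnessed (\<lambda>x. length s < length t \<longrightarrow> (if s = take (length s) t
      then \<forall>n. T x s n \<longrightarrow> label x s n = t ! length s
      else (\<exists>n. T x s n) \<and> (\<forall>n m. T x s n \<and> T x s m \<longrightarrow> label x s n = label x s m)))"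
    by (intro witnessed_imp witnessed_const)
qed

lemma consistent_take: assumes "consistent x t" shows "consistent x (take m t)"
  unfolding consistent_def
proof (intro allI impI)
  fix s :: "bool list" assume s: "length s < length (take m t)"
  then have "take (length s) (take m t) = take (length s) t" "take m t ! length s = t ! length s" and len: "length s < length t"
    by (simp_all add: min_absorb1)
  then show "if s = take (length s) (take m t) then \<forall>n. T x s n \<longrightarrow> label x s n = take m t ! length s
      else (\<exists>n. T x s n) \<and> (\<forall>n m. T x s n \<and> T x s m \<longrightarrow> label x s n = label x s m)"
    using assms[unfolded consistent_def, THEN spec, THEN mp, OF len] by (simp only:)
qed

lemma on_branch_iff_map: "on_branch i s \<longleftrightarrow> map i [0..<length s] = s"
proof
  assume "on_branch i s"
  then show "map i [0..<length s] = s" by (intro nth_equalityI) (simp_all add: on_branch_def)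
next
  assume eq: "map i [0..<length s] = s"
  have "s ! k = i k" if "k < length s" for k
  proof -
    have "map i [0..<length s] ! k = i k" using that by simp
    then show ?thesis by (simp only: eq)
  qed
  then show "on_branch i s" by (simp add: on_branch_def)
qed

lemma F_iff_consistent: "(i, x) \<in> F \<longleftrightarrow> (\<forall>m. consistent x (map i [0..<m]))"
proof -
  have "consistent x (map i [0..<m]) \<longleftrightarrow> (\<forall>s. length s < m \<longrightarrow> (if on_branch i s
      then \<forall>n. T x s n \<longrightarrow> label x s n = i (length s)
      else (\<exists>n. T x s n) \<and> (\<forall>n m. T x s n \<and> T x s m \<longrightarrow> label x s n = label x s m)))" for m
  proof -
    have *: "s = take (length s) (map i [0..<m]) \<longleftrightarrow> on_branch i s" "map i [0..<m] ! length s = i (length s)"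
      if "length s < m" for s
    proof -
      have "take (length s) (map i [0..<m]) = map i [0..<length s]" using that by (simp add: take_map)
      then show "s = take (length s) (map i [0..<m]) \<longleftrightarrow> on_branch i s" unfolding on_branch_iff_map by metis
    qed (use that in simp)
    show ?thesis unfolding consistent_def by (intro all_cong1) (simp add: * cong: imp_cong)
  qed
  note * = this
  show ?thesis unfolding F_def mem_Collect_eq fst_conv snd_conv *
    by (intro iffI conjI allI impI) (metis lessI)+
qed

definition extendible :: "(nat \<Rightarrow> bool) \<Rightarrow> bool list \<Rightarrow> bool" where
  "extendible x t \<longleftrightarrow> (\<exists>i. on_branch i t \<and> (i, x) \<in> F)"

text \<open>Compactness replaces the quantifier over branches by countable ones. The equation
  between the two \<open>take\<close> terms says that \<open>t\<close> and \<open>t'\<close> are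
  comparable, for levels on either side of \<open>length t\<close>.\<close>

lemma extendible_iff: "extendible x t \<longleftrightarrow> (\<forall>m. \<exists>t'. length t' = m \<and> consistent x t' \<and> take (length t) t' = take m t)"
proof
  assume "extendible x t"
  then obtain i where i: "on_branch i t" "(i, x) \<in> F" by (auto simp: extendible_def)
  have "take (length t) (map i [0..<m]) = take m t" for m
    using i(1) by (auto simp: on_branch_def list_eq_iff_nth_eq)
  then show "\<forall>m. \<exists>t'. length t' = m \<and> consistent x t' \<and> take (length t) t' = take m t"
    using i(2) unfolding F_iff_consistent by (metis diff_zero length_map length_upt)
next
  assume r: "\<forall>m. \<exists>t'. length t' = m \<and> consistent x t' \<and> take (length t) t' = take m t"
  define Q where "Q t' \<longleftrightarrow> consistent x t' \<and> take (length t) t' = take (length t') t" for t'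
  have "\<exists>i. \<forall>m. Q (map i [0..<m])"
  proof (rule binary_Koenig)
    show "Q (take m t')" if "Q t'" for t' m
    proof -
      have "take (length t) (take m t') = take m (take (length t) t')" by (simp add: min.commute)
      also have "\<dots> = take (length (take m t')) t" using that by (simp add: Q_def min.commute)
      finally show ?thesis using that consistent_take by (simp add: Q_def)
    qed
    show "\<exists>t'. length t' = m \<and> Q t'" for m using r unfolding Q_def by metis
  qed
  then obtain i where i: "\<And>m. Q (map i [0..<m])" by blast
  have "on_branch i t" using i[of "length t"] by (simp add: Q_def on_branch_iff_map)
  moreover have "(i, x) \<in> F" using i unfolding F_iff_consistent Q_def by blast
  ultimately show "extendible x t" by (auto simp: extendible_def)
qed

lemma witnessed_extendible: "witnessed (\<lambda>x. extendible x t)"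
  unfolding extendible_iff by (intro witnessed_all witnessed_ex witnessed_conj witnessed_consistent witnessed_const)

section \<open>Counting the admissible branches\<close>

text \<open>A true statement at the last common string would have to carry both of the following
  bits as its label.\<close>

lemma split_point:
  assumes "(i, x) \<in> F" "(i', x) \<in> F" "i \<noteq> i'"
  shows "\<exists>k. i k \<noteq> i' k \<and> (\<forall>i'' m. (i'', x) \<in> F \<longrightarrow> m < k \<longrightarrow> i'' m = i m)"
proof -
  define k where "k = (LEAST k. i k \<noteq> i' k)"
  have k: "i k \<noteq> i' k" using assms(3) LeastI_ex[of "\<lambda>k. i k \<noteq> i' k"] by (auto simp: k_def)
  have below: "i m = i' m" if "m < k" for m using not_less_Least that unfolding k_def by blast
  define s where "s = map i [0..<k]"
  have on_branch: "on_branch i s" "on_branch i' s" and len: "length s = k" by (auto simp: s_def on_branch_def below)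
  have no: "\<not> T x s n" for n
  proof
    assume "T x s n"
    then have "label x s n = i (length s)" "label x s n = i' (length s)"
      using assms(1,2) on_branch unfolding F_def mem_Collect_eq fst_conv snd_conv by blast+
    then show False using k len by simp
  qed
  have "i'' m = i m" if "(i'', x) \<in> F" "m < k" for i'' m
  proof -
    have "on_branch i'' s" using that(1) no unfolding F_def mem_Collect_eq fst_conv snd_conv by blast
    then show ?thesis using that(2) by (simp add: on_branch_def s_def)
  qed
  then show ?thesis using k by blast
qed

text \<open>All three pairs would part at the same position, but three bits cannot be pairwise
  different.\<close>

lemma at_most_two:
  assumes F: "(i, x) \<in> F" "(j, x) \<in> F" "(l, x) \<in> F"
  shows "i = j \<or> i = l \<or> j = l"
proof (rule ccontr)
  assume "\<not> ?thesis"
  then have ne: "i \<noteq> j" "i \<noteq> l" "j \<noteq> l" by auto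
  obtain k1 where k1: "i k1 \<noteq> j k1" "\<And>i'' m. (i'', x) \<in> F \<Longrightarrow> m < k1 \<Longrightarrow> i'' m = i m"
    using split_point[OF F(1,2) ne(1)] by blast
  obtain k2 where k2: "i k2 \<noteq> l k2" "\<And>i'' m. (i'', x) \<in> F \<Longrightarrow> m < k2 \<Longrightarrow> i'' m = i m"
    using split_point[OF F(1,3) ne(2)] by blast
  obtain k3 where k3: "j k3 \<noteq> l k3" "\<And>i'' m. (i'', x) \<in> F \<Longrightarrow> m < k3 \<Longrightarrow> i'' m = j m"
    using split_point[OF F(2,3) ne(3)] by blast
  have "k1 = k2" using k1(1) k2(1) k1(2)[OF F(3), of k2] k2(2)[OF F(2), of k1] by (metis linorder_neqE_nat)
  moreover have "k1 = k3"
    using k1(1) k3(1) k3(2)[OF F(1), of k1] k1(2)[OF F(2), of k3] k1(2)[OF F(3), of k3] by (metis linorder_neqE_nat)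
  ultimately show False using k1(1) k2(1) k3(1) by blast
qed

definition two :: "(nat \<Rightarrow> bool) \<Rightarrow> bool" where
  "two x \<longleftrightarrow> (\<exists>i j. i \<noteq> j \<and> (i, x) \<in> F \<and> (j, x) \<in> F)"

lemma two_iff_extendible: "two x \<longleftrightarrow> (\<exists>t t'. (length t = length t' \<and> t \<noteq> t') \<and> extendible x t \<and> extendible x t')"
proof
  assume "two x"
  then obtain i j k where ij: "i k \<noteq> j k" "(i, x) \<in> F" "(j, x) \<in> F" by (auto simp: two_def fun_eq_iff)
  have "extendible x (map i [0..<Suc k])" "extendible x (map j [0..<Suc k])"
    unfolding extendible_def by (rule exI[of _ i], use ij in \<open>simp add: on_branch_iff_map\<close>)
      (rule exI[of _ j], use ij in \<open>simp add: on_branch_iff_map\<close>)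
  moreover have "map i [0..<Suc k] \<noteq> map j [0..<Suc k]" using ij(1) by simp
  ultimately show "\<exists>t t'. (length t = length t' \<and> t \<noteq> t') \<and> extendible x t \<and> extendible x t'"
    by (intro exI[of _ "map i [0..<Suc k]"] exI[of _ "map j [0..<Suc k]"]) auto
next
  assume "\<exists>t t'. (length t = length t' \<and> t \<noteq> t') \<and> extendible x t \<and> extendible x t'"
  then obtain t t' where t: "length t = length t'" "t \<noteq> t'" "extendible x t" "extendible x t'" by blast
  then obtain i j where ij: "on_branch i t" "on_branch j t'" "(i, x) \<in> F" "(j, x) \<in> F" unfolding extendible_def by blast
  then have "i \<noteq> j" using on_branch_unique t(1,2) by blast
  then show "two x" unfolding two_def using ij(3,4) by blast
qed

text \<open>The filler with tag 1 stands over each \<open>x\<close> with at most one branch, the one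
  with tag 2 over each \<open>x\<close> with none, which makes two points in every case.\<close>

theorem closed_two_point_extension:
  "\<exists>C. closedin CB_top C \<and> embed ` F \<subseteq> C \<and> (\<forall>x. \<exists>y1 y2. y1 \<noteq> y2 \<and> {y. (x, y) \<in> C} = {y1, y2})"
proof -
  have "witnessed (\<lambda>x. \<not> two x)" unfolding two_iff_extendible by (intro witnessed_not witnessed_ex witnessed_conj witnessed_extendible witnessed_const)
  then obtain h1 where h1: "closed_graph h1" "\<And>x. \<not> two x \<longleftrightarrow> h1 x 0 = 0" by (auto simp: witnessed_def)
  have "witnessed (\<lambda>x. \<not> extendible x [])" by (intro witnessed_not witnessed_extendible)
  then obtain h0 where h0: "closed_graph h0" "\<And>x. \<not> extendible x [] \<longleftrightarrow> h0 x 0 = 0" by (auto simp: witnessed_def)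
  define C where "C = embed ` F \<union> {(x, case_nat 1 (h1 x)) |x. h1 x 0 = 0} \<union> {(x, case_nat 2 (h0 x)) |x. h0 x 0 = 0}"
  have graph: "p \<in> {(x, case_nat c (h x)) |x. h x 0 = 0}"
    if h: "closed_graph h" and q: "\<And>k. q k \<in> {(x, case_nat c (h x)) |x. h x 0 = 0}"
      and lim: "\<And>m. \<forall>\<^sub>F k in sequentially. fst (q k) m = fst p m" "\<And>m. \<forall>\<^sub>F k in sequentially. snd (q k) m = snd p m"
    for h c p and q :: "nat \<Rightarrow> (nat \<Rightarrow> bool) \<times> (nat \<Rightarrow> nat)"
  proof -
    have sq: "snd (q k) = case_nat c (h (fst (q k)))" "h (fst (q k)) 0 = 0" for k using q[of k] by auto
    have "\<forall>\<^sub>F k in sequentially. h (fst (q k)) m = snd p (Suc m)" for m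
      using lim(2)[of "Suc m"] by (simp add: sq(1))
    from closed_graphD[OF h lim(1) this] have hp: "h (fst p) = (\<lambda>m. snd p (Suc m))" .
    \<comment> \<open>The tag shifts the value of \<open>h\<close> by one place, so
      \<open>h x 0 = 0\<close> is read at coordinate 1.\<close>
    have "\<forall>\<^sub>F k in sequentially. snd p (Suc 0) = 0 \<and> snd p 0 = c"
      using lim(2)[of 0] lim(2)[of "Suc 0"] by eventually_elim (simp add: sq)
    then have p0: "snd p (Suc 0) = 0" "snd p 0 = c" by simp_all
    have "snd p = case_nat c (h (fst p))" using p0 by (auto simp: hp fun_eq_iff split: nat.split)
    moreover have "h (fst p) 0 = 0" using p0 by (simp add: hp)
    ultimately show ?thesis by (auto intro!: exI[of _ "fst p"] simp: prod_eq_iff)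
  qed
  have main: "p \<in> embed ` F"
    if q: "\<And>k. q k \<in> embed ` F" and lim: "\<And>m. \<forall>\<^sub>F k in sequentially. fst (q k) m = fst p m"
      "\<And>m. \<forall>\<^sub>F k in sequentially. snd (q k) m = snd p m" for p and q :: "nat \<Rightarrow> (nat \<Rightarrow> bool) \<times> (nat \<Rightarrow> nat)"
  proof -
    obtain z where z: "\<And>k. z k \<in> F" "\<And>k. q k = embed (z k)" using q unfolding image_iff by metis
    have "\<forall>\<^sub>F k in sequentially. obs_seq {} {} (z k) m = snd p (Suc m)" for m
      using lim(2)[of "Suc m"] by (simp add: z(2) embed_def)
    then obtain w where w: "w \<in> F" "obs_seq {} {} w = (\<lambda>m. snd p (Suc m))"
      using code_space.limit[OF code_space_F[OF down_closed_empty], of z "\<lambda>m. snd p (Suc m)"] z(1) by blast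
    have "\<forall>\<^sub>F k in sequentially. snd p 0 = 0" using lim(2)[of 0] by eventually_elim (simp add: z(2) embed_def)
    then have "snd (embed w) = snd p" by (auto simp: embed_def w(2) fun_eq_iff split: nat.split)
    \<comment> \<open>The limit axiom yields only the observations of \<open>w\<close>; its second
      component is recovered from the bits \<open>Xb\<close> among them.\<close>
    moreover have "snd w m = fst p m" for m
    proof -
      have "obs_seq {} {} w (to_nat (Xb m)) = snd p (Suc (to_nat (Xb m)))" using w(2) by simp
      then have *: "of_bool (snd w m) = snd p (Suc (to_nat (Xb m)))" by (simp add: obs_seq_def obs_def)
      have "\<forall>\<^sub>F k in sequentially. snd w m = fst p m"
        using lim(2)[of "Suc (to_nat (Xb m))"] lim(1)[of m]
      proof eventually_elim
        case (elim k)
        then have "of_bool (fst p m) = snd p (Suc (to_nat (Xb m)))" by (simp add: z(2) embed_def obs_seq_def obs_def)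
        then show ?case using * by (metis of_bool_eq_iff)
      qed
      then show ?thesis by simp
    qed
    ultimately have "p = embed w" by (simp add: prod_eq_iff fun_eq_iff)
    then show ?thesis using w(1) by blast
  qed
  have tag: "q \<in> C \<longleftrightarrow> (if snd q 0 = 0 then q \<in> embed ` F else if snd q 0 = 1 then q \<in> {(x, case_nat 1 (h1 x)) |x. h1 x 0 = 0}
      else q \<in> {(x, case_nat 2 (h0 x)) |x. h0 x 0 = 0})" for q
    by (auto simp: C_def embed_def)
  have "openin CB_top (UNIV - C)" unfolding openin_CB_top
  proof (rule ballI, rule ccontr)
    fix p assume p: "p \<in> UNIV - C" and "\<nexists>N. \<forall>q. (\<forall>k<N. fst q k = fst p k \<and> snd q k = snd p k) \<longrightarrow> q \<in> UNIV - C"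
    then have "\<forall>N. \<exists>q. (\<forall>k<N. fst q k = fst p k \<and> snd q k = snd p k) \<and> q \<in> C" by blast
    then obtain q where q: "\<And>N k. k < N \<Longrightarrow> fst (q N) k = fst p k \<and> snd (q N) k = snd p k" "\<And>N. q N \<in> C" by metis
    \<comment> \<open>The shift makes every member of the sequence agree with \<open>p\<close> at
      coordinate 0, hence in the tag.\<close>
    define q' where "q' N = q (Suc N)" for N
    have lim: "\<forall>\<^sub>F k in sequentially. fst (q' k) m = fst p m" "\<forall>\<^sub>F k in sequentially. snd (q' k) m = snd p m" for m
      using eventually_ge_at_top[of m] by (eventually_elim, simp add: q'_def q(1))+
    have t: "snd (q' k) 0 = snd p 0" "q' k \<in> C" for k using q by (simp_all add: q'_def)
    have "p \<in> C"
      using tag[of p] tag[of "q' _"] t main[of q', OF _ lim] graph[OF h1(1), of q' 1, OF _ lim] graph[OF h0(1), of q' 2, OF _ lim]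
      by (metis (no_types, lifting))
    then show False using p by blast
  qed
  then have "closedin CB_top C" by (simp add: closedin_def)
  moreover have "\<exists>y1 y2. y1 \<noteq> y2 \<and> {y. (x, y) \<in> C} = {y1, y2}" for x
  proof -
    let ?c0 = "case_nat 2 (h0 x) :: nat \<Rightarrow> nat" and ?c1 = "case_nat 1 (h1 x) :: nat \<Rightarrow> nat"
    have sec: "{y. (x, y) \<in> C} = {snd (embed (i, x)) |i. (i, x) \<in> F} \<union> (if two x then {} else {?c1}) \<union> (if extendible x [] then {} else {?c0})"
    proof -
      have "(x, y) \<in> embed ` F \<longleftrightarrow> (\<exists>i. (i, x) \<in> F \<and> y = snd (embed (i, x)))" for y
      proof
        assume "(x, y) \<in> embed ` F"
        then obtain z where "z \<in> F" "(x, y) = embed z" by blast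
        then show "\<exists>i. (i, x) \<in> F \<and> y = snd (embed (i, x))" by (intro exI[of _ "fst z"]) (metis fst_conv fst_embed prod.collapse snd_conv)
      next
        assume "\<exists>i. (i, x) \<in> F \<and> y = snd (embed (i, x))"
        then show "(x, y) \<in> embed ` F" by (metis fst_embed image_eqI prod.collapse snd_conv)
      qed
      then show ?thesis using h1(2)[of x] h0(2)[of x] by (auto simp: C_def)
    qed
    have se: "snd (embed z) 0 = 0" for z by (simp add: embed_def)
    have ne: "snd (embed z) \<noteq> ?c1" "snd (embed z) \<noteq> ?c0" "?c1 \<noteq> ?c0" for z
    proof -
      have "?c1 0 = 1" "?c0 0 = 2" by simp_all
      then show "snd (embed z) \<noteq> ?c1" "snd (embed z) \<noteq> ?c0" "?c1 \<noteq> ?c0" using se[of z] by (metis zero_neq_one, metis zero_neq_numeral, metis one_eq_numeral_iff num.distinct(1))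
    qed
    have e0: "extendible x [] \<longleftrightarrow> (\<exists>i. (i, x) \<in> F)" by (simp add: extendible_def on_branch_def)
    consider "two x" | i where "\<not> two x" "(i, x) \<in> F" | "\<not> extendible x []" using e0 by blast
    then show ?thesis
    proof cases
      case 1
      then obtain i j where ij: "i \<noteq> j" "(i, x) \<in> F" "(j, x) \<in> F" by (auto simp: two_def)
      have "{snd (embed (i, x)) |i. (i, x) \<in> F} = {snd (embed (i, x)), snd (embed (j, x))}"
        using at_most_two[OF ij(2,3)] ij by blast
      moreover have "extendible x []" using e0 ij by blast
      moreover have "snd (embed (i, x)) \<noteq> snd (embed (j, x))"
      proof
        assume "snd (embed (i, x)) = snd (embed (j, x))"
        then have "embed (i, x) = embed (j, x)" by (simp add: prod_eq_iff)
        then show False using embed_inj ij(1) by blast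
      qed
      ultimately show ?thesis using 1 sec by auto
    next
      case (2 i)
      have "j = i" if "(j, x) \<in> F" for j using 2 that unfolding two_def by blast
      then have "{snd (embed (i, x)) |i. (i, x) \<in> F} = {snd (embed (i, x))}" using 2(2) by blast
      moreover have "extendible x []" using e0 2 by blast
      ultimately have "{y. (x, y) \<in> C} = {snd (embed (i, x)), ?c1}" using 2 sec by auto
      then show ?thesis using ne(1) by blast
    next
      case 3
      then have "{snd (embed (i, x)) |i. (i, x) \<in> F} = {}" "\<not> two x" using e0 by (auto simp: two_def)
      then have "{y. (x, y) \<in> C} = {?c1, ?c0}" using 3 sec by auto
      then show ?thesis using ne(3) by blast
    qed
  qed
  moreover have "embed ` F \<subseteq> C" by (auto simp: C_def)
  ultimately show ?thesis by blast
qed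

end

section \<open>From countable well-orders to ranks\<close>

text \<open>Numbers outside the image of \<open>f\<close> are put above it in their natural order.
  This well-orders all of the natural numbers without changing the initial segments below members of
  the image.\<close>

lemma ranks_of_well_order:
  fixes r :: "('i \<times> 'i) set" and f :: "'i \<Rightarrow> nat"
  assumes wo: "Well_order r" and inj: "inj_on f (Field r)"
  defines "I \<equiv> f ` Field r"
  defines "lt \<equiv> \<lambda>m n. (\<exists>b c. m = f b \<and> n = f c \<and> (b, c) \<in> r \<and> b \<noteq> c) \<or> m \<in> I \<and> n \<notin> I \<or> m \<notin> I \<and> n \<notin> I \<and> m < n"
  shows "ranks lt"
proof
  have lin: "refl_on (Field r) r" "trans r" "antisym r" "total_on (Field r) r" and wf: "wf (r - Id)"
    using wo by (auto simp: order_on_defs)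
  have fld: "b \<in> Field r" "c \<in> Field r" if "(b, c) \<in> r" for b c using that by (auto simp: Field_def)
  have ltI: "lt (f b) (f c) \<longleftrightarrow> (b, c) \<in> r \<and> b \<noteq> c" if bc: "b \<in> Field r" "c \<in> Field r" for b c
  proof
    assume l: "lt (f b) (f c)"
    have "f b \<in> I" "f c \<in> I" using bc by (simp_all add: I_def)
    then obtain b' c' where bc': "f b = f b'" "f c = f c'" "(b', c') \<in> r" "b' \<noteq> c'"
      using l unfolding lt_def by blast
    have "b = b'" "c = c'" using inj_onD[OF inj] bc bc' fld by blast+
    then show "(b, c) \<in> r \<and> b \<noteq> c" using bc' by simp
  next
    assume "(b, c) \<in> r \<and> b \<noteq> c"
    then show "lt (f b) (f c)" unfolding lt_def by blast
  qed
  have inI: "m \<in> I \<and> n \<in> I" if "m = f b \<and> n = f c \<and> (b, c) \<in> r \<and> b \<noteq> c" for m n b c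
    using that fld by (auto simp: I_def)
  have ltO: "lt m n \<longleftrightarrow> m \<in> I \<or> m < n" if "n \<notin> I" for m n
    using that inI unfolding lt_def by blast
  have ltN: "\<not> lt m n" if "m \<notin> I" "n \<in> I" for m n
    using that inI unfolding lt_def by blast
  show "wf {(c, d). lt c d}" unfolding wf_eq_minimal
  proof (intro allI impI)
    fix Q :: "nat set" and q assume q: "q \<in> Q"
    show "\<exists>z\<in>Q. \<forall>y. (y, z) \<in> {(c, d). lt c d} \<longrightarrow> y \<notin> Q"
    proof (cases "Q \<inter> I = {}")
      case True
      have "(LEAST n. n \<in> Q) \<in> Q" using q by (rule LeastI)
      moreover have "y \<notin> Q" if "lt y (LEAST n. n \<in> Q)" for y
      proof -
        have "(LEAST n. n \<in> Q) \<notin> I" using True calculation by blast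
        then have "y \<in> I \<or> y < (LEAST n. n \<in> Q)" using ltO that by blast
        then show ?thesis using True not_less_Least by blast
      qed
      ultimately show ?thesis by blast
    next
      case False
      then obtain b where "b \<in> {b \<in> Field r. f b \<in> Q}" by (auto simp: I_def)
      then obtain c where c: "c \<in> {b \<in> Field r. f b \<in> Q}" "\<And>y. (y, c) \<in> r - Id \<Longrightarrow> y \<notin> {b \<in> Field r. f b \<in> Q}"
        using wf unfolding wf_eq_minimal by metis
      have "y \<notin> Q" if "lt y (f c)" for y
      proof
        assume y: "y \<in> Q"
        have "y \<in> I" using ltN[of y "f c"] that c(1) by (auto simp: I_def)
        then obtain d where d: "d \<in> Field r" "y = f d" by (auto simp: I_def)
        then have "(d, c) \<in> r - Id" using ltI[of d c] that c(1) by auto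
        then show False using c(2) d y by blast
      qed
      then show ?thesis using c(1) by blast
    qed
  qed
  show "lt c e" if "lt c d" "lt d e" for c d e
  proof (cases "e \<in> I")
    case True
    then have "d \<in> I" using ltN that(2) by blast
    then have "c \<in> I" using ltN that(1) by blast
    obtain c' d' e' where s: "c = f c'" "d = f d'" "e = f e'" "c' \<in> Field r" "d' \<in> Field r" "e' \<in> Field r"
      using True \<open>d \<in> I\<close> \<open>c \<in> I\<close> by (auto simp: I_def)
    then have "(c', d') \<in> r \<and> c' \<noteq> d'" "(d', e') \<in> r \<and> d' \<noteq> e'" using that ltI by auto
    then have "(c', e') \<in> r \<and> c' \<noteq> e'" using lin(2,3) by (metis antisymD transD)
    then show ?thesis using s ltI by simp
  next
    case False
    then have d: "d \<in> I \<or> d < e" using that(2) ltO by blast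
    have "c \<in> I \<or> c < e"
    proof (cases "d \<in> I")
      case True then show ?thesis using ltN that(1) by blast
    next
      case dI: False
      then have "c \<in> I \<or> c < d" using that(1) ltO by blast
      then show ?thesis using d dI by auto
    qed
    then show ?thesis using ltO[OF False] by blast
  qed
  show "lt c d \<or> c = d \<or> lt d c" for c d
  proof (cases "c \<in> I \<and> d \<in> I")
    case True
    then obtain c' d' where s: "c = f c'" "d = f d'" "c' \<in> Field r" "d' \<in> Field r" by (auto simp: I_def)
    then show ?thesis using ltI lin(4) unfolding total_on_def by metis
  next
    case False
    then show ?thesis using ltO[of c d] ltO[of d c] by auto
  qed
qed

lemma Sigma_class_transport:
  assumes "Sigma_class X r b S" "\<And>c d. (c, d) \<in> r \<Longrightarrow> c \<noteq> d \<Longrightarrow> (f c, f d) \<in> r' \<and> f c \<noteq> f d"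
  shows "Sigma_class X r' (f b) S"
  using assms(1)
proof induction
  case (open_class S b)
  then show ?case by (rule Sigma_class.open_class)
next
  case (union_class b A)
  then show ?case using assms(2) by (intro Sigma_class.union_class) meson
qed

theorem theorem1p1:
  fixes r :: "('i \<times> 'i) set" and a :: 'i
  assumes "Well_order r" and "countable (Field r)" and "a \<in> Field r"
  shows "\<exists>F. closedin CB_top F
           \<and> (\<forall>x. \<exists>y1 y2. y1 \<noteq> y2 \<and> {y. (x, y) \<in> F} = {y1, y2})
           \<and> \<not> (\<exists>B :: nat \<Rightarrow> ((nat \<Rightarrow> bool) \<times> (nat \<Rightarrow> nat)) set.
                   (\<forall>n. B n \<subseteq> F \<and> Sigma_class CB_top r a (B n)
                        \<and> (\<forall>x. \<forall>y1 y2. (x, y1) \<in> B n \<and> (x, y2) \<in> B n \<longrightarrow> y1 = y2))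
                   \<and> F \<subseteq> (\<Union>n. B n))"
proof -
  obtain f :: "'i \<Rightarrow> nat" where f: "inj_on f (Field r)" using assms(2) by (auto simp: countable_def)
  define I where "I = f ` Field r"
  define lt where "lt m n \<longleftrightarrow> (\<exists>b c. m = f b \<and> n = f c \<and> (b, c) \<in> r \<and> b \<noteq> c) \<or> m \<in> I \<and> n \<notin> I \<or> m \<notin> I \<and> n \<notin> I \<and> m < n"
    for m n
  \<comment> \<open>The statements receive the index of the class allowed to the pieces, but are
    multiplicative where the pieces are additive.\<close>
  interpret ranks lt "f a"
    using ranks_of_well_order[OF assms(1) f] unfolding lt_def I_def .
  obtain C where C: "closedin CB_top C" "embed ` F \<subseteq> C" "\<forall>x. \<exists>y1 y2. y1 \<noteq> y2 \<and> {y. (x, y) \<in> C} = {y1, y2}"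
    using closed_two_point_extension by blast
  have tp: "(f c, f d) \<in> R \<and> f c \<noteq> f d" if "(c, d) \<in> r" "c \<noteq> d" for c d
  proof -
    have "lt (f c) (f d)" using that unfolding lt_def by blast
    then show ?thesis using lt_irrefl by auto
  qed
  have False if B: "\<forall>n. B n \<subseteq> C \<and> Sigma_class CB_top r a (B n)
      \<and> (\<forall>x. \<forall>y1 y2. (x, y1) \<in> B n \<and> (x, y2) \<in> B n \<longrightarrow> y1 = y2)" "C \<subseteq> (\<Union>n. B n)" for B :: "nat \<Rightarrow> _"
  proof (rule not_covered)
    show "Sigma_class CB_top R (f a) (B n)" for n using B(1) by (intro Sigma_class_transport[OF _ tp]) auto
    show "y1 = y2" if "(x, y1) \<in> B n" "(x, y2) \<in> B n" for n x y1 y2 using B(1) that by blast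
    show "embed ` F \<subseteq> (\<Union>n. B n)" using B(2) C(2) by blast
  qed
  then have "\<not> (\<exists>B. (\<forall>n. B n \<subseteq> C \<and> Sigma_class CB_top r a (B n)
      \<and> (\<forall>x. \<forall>y1 y2. (x, y1) \<in> B n \<and> (x, y2) \<in> B n \<longrightarrow> y1 = y2)) \<and> C \<subseteq> (\<Union>n :: nat. B n))"
    by (intro notI, elim exE conjE)
  with C(1,3) show ?thesis by (intro exI[of _ C] conjI)
qed

end
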